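(* Let $G,H:\mathbb{R}^2\to\mathbb{R}$ be $C^1$ functions. Consider the piecewise-defined planar vector field $F=(F_1,F_2)$ on $\mathbb{R}\times\mathbb{R}$ given by $$\dot x = G(x,y),\qquad \dot y=\begin{cases} -|H(x,y)| & \text{if } y>1,\\[2pt] \dfrac{H(x,y)-|H(x,y)|}{2} & \text{if } y=1,\\[4pt] H(x,y) & \text{if } 0<y<1,\\[2pt] \dfrac{H(x,y)+|H(x,y)|}{2} & \text{if } y=0,\\[4pt] |H(x,y)| & \text{if } y<0. \end{cases}$$ Then for every initial condition $(x(0),y(0))\in\mathbb{R}^2$ the initial value problem $\dot z=F(z)$ has a Filippov solution, and this Filippov solution is unique in forward time. Furthermore, the strip $\mathbb{R}\times[0,1]$ is forward invariant: any Filippov solution starting in $\mathbb{R}\times[0,1]$ remains in $\mathbb{R}\times[0,1]$ for all forward times for which it is defined.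
   Context: Filippov solutions: for a locally essentially bounded vector field $F:\mathbb{R}^2\to\mathbb{R}^2$, define the set-valued map $\mathcal{K}[F](z)=\bigcap_{\delta>0}\bigcap_{\mu(N)=0}\overline{\mathrm{co}}\,F(B_\delta(z)\setminus N)$, where $\mu$ is Lebesgue measure, $B_\delta(z)$ the open ball of radius $\delta$ about $z$, and $\overline{\mathrm{co}}$ the closed convex hull. A Filippov solution of $\dot z=F(z)$ on an interval $I$ is an absolutely continuous curve $z:I\to\mathbb{R}^2$ with $\dot z(t)\in\mathcal{K}[F](z(t))$ for almost every $t\in I$. "Unique in forward time" means any two Filippov solutions with the same initial value coincide on their common forward time interval. *)

theory Defs
  imports "HOL-Analysis.Analysis"
begin

definition C1_plane :: "(real \<times> real \<Rightarrow> real) \<Rightarrow> bool" where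
  "C1_plane f \<longleftrightarrow> (\<exists>f' :: real \<times> real \<Rightarrow> ((real \<times> real) \<Rightarrow>\<^sub>L real).
      (\<forall>z. (f has_derivative blinfun_apply (f' z)) (at z)) \<and> continuous_on UNIV f')"

definition field :: "(real \<times> real \<Rightarrow> real) \<Rightarrow> (real \<times> real \<Rightarrow> real) \<Rightarrow> real \<times> real \<Rightarrow> real \<times> real" where
  "field G H = (\<lambda>(x, y). (G (x, y),
      (if y > 1 then - \<bar>H (x, y)\<bar>
       else if y = 1 then (H (x, y) - \<bar>H (x, y)\<bar>) / 2
       else if 0 < y then H (x, y)
       else if y = 0 then (H (x, y) + \<bar>H (x, y)\<bar>) / 2
       else \<bar>H (x, y)\<bar>)))"

definition filippov_map :: "(real \<times> real \<Rightarrow> real \<times> real) \<Rightarrow> real \<times> real \<Rightarrow> (real \<times> real) set" where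
  "filippov_map F z = (\<Inter>\<delta>\<in>{0<..}. \<Inter>N\<in>null_sets lebesgue.
      closure (convex hull (F ` (ball z \<delta> - N))))"

definition abs_cont_on :: "(real \<Rightarrow> 'a::real_normed_vector) \<Rightarrow> real \<Rightarrow> real \<Rightarrow> bool" where
  "abs_cont_on f a b \<longleftrightarrow> (\<forall>\<epsilon>>0. \<exists>\<delta>>0. \<forall>(n::nat) (l::nat \<Rightarrow> real) (r::nat \<Rightarrow> real).
      (\<forall>i<n. a \<le> l i \<and> l i \<le> r i \<and> r i \<le> b) \<and>
      (\<forall>i<n. \<forall>j<n. i \<noteq> j \<longrightarrow> r i \<le> l j \<or> r j \<le> l i) \<and>
      (\<Sum>i<n. r i - l i) < \<delta> \<longrightarrow> (\<Sum>i<n. norm (f (r i) - f (l i))) < \<epsilon>)"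

definition loc_abs_cont_on :: "(real \<Rightarrow> 'a::real_normed_vector) \<Rightarrow> real set \<Rightarrow> bool" where
  "loc_abs_cont_on f I \<longleftrightarrow> (\<forall>a b. {a..b} \<subseteq> I \<longrightarrow> abs_cont_on f a b)"

definition filippov_solution :: "(real \<times> real \<Rightarrow> real \<times> real) \<Rightarrow> (real \<Rightarrow> real \<times> real) \<Rightarrow> real set \<Rightarrow> bool" where
  "filippov_solution F z I \<longleftrightarrow> is_interval I \<and> loc_abs_cont_on z I \<and>
     (AE t in lebesgue. t \<in> I \<longrightarrow>
        (\<exists>v. (z has_vector_derivative v) (at t within I) \<and> v \<in> filippov_map F (z t)))"

end

theory Submission
  imports Defs
begin

text \<open>
  The second component of the field is nonincreasing in \<open>y\<close> and 1-Lipschitz in the value of \<open>H\<close>, because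
  \<open>- \<bar>H\<bar> \<le> H \<le> \<bar>H\<bar>\<close>. Hence the field is locally one-sided Lipschitz; the inequality is affine in each of
  the two field values and so passes to the convexified map, and Gronwall's inequality gives forward uniqueness.
  Above the strip every Filippov velocity points down and below it every one points up, which gives
  invariance. Existence only needs an argument on the lines \<open>y = 1\<close> and \<open>y = 0\<close>: there one solves the
  Lipschitz equation with right-hand side \<open>(G, H)\<close>, reflected into the strip. While the reflected
  solution rests on the boundary, \<open>H\<close> points outwards, so \<open>(G, 0)\<close> is a convex combination of the two
  one-sided limits \<open>(G, H)\<close> and \<open>(G, - H)\<close> of the field.
\<close>

section \<open>Absolutely continuous functions\<close>

text \<open>Zeros of \<open>H\<close> along a switching line may accumulate, so a solution started
  there cannot be pieced together from sliding phases and phases inside the strip. Reflection covers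
  both at once: the solution leaves the line when the drift points inwards, where the two one-sided
  limits of the field agree, and is held on it otherwise. The contact times may form a Cantor set of
  positive measure, which is why the existence part needs a statement about derivatives on zero sets
  at almost every time. Filippov velocities, too, exist only almost everywhere. Invariance and
  uniqueness therefore rest on one fact: an absolutely continuous function with nonpositive
  derivative almost everywhere does not increase.\<close>

lemma vector_derivative_nonpos_local_bound:
  fixes f :: "real \<Rightarrow> real"
  assumes der: "(f has_vector_derivative v) (at t within S)" and v: "v \<le> 0" and e: "e > 0"
  obtains d where "d > 0"
    "\<And>p q. p \<in> S \<Longrightarrow> q \<in> S \<Longrightarrow> p \<le> t \<Longrightarrow> t \<le> q \<Longrightarrow> p \<in> ball t d \<Longrightarrow> q \<in> ball t d \<Longrightarrow> f q - f p \<le> e * (q - p)"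
proof -
  obtain d where d: "d > 0" and
    *: "\<And>y. y \<in> S \<Longrightarrow> \<bar>y - t\<bar> < d \<Longrightarrow> \<bar>f y - f t - (y - t) * v\<bar> \<le> e * \<bar>y - t\<bar>"
    using der e unfolding has_vector_derivative_def has_derivative_within_alt by fastforce
  show ?thesis
  proof (rule that[OF d])
    fix p q assume H: "p \<in> S" "q \<in> S" "p \<le> t" "t \<le> q" "p \<in> ball t d" "q \<in> ball t d"
    \<comment> \<open>As \<open>p\<close> and \<open>q\<close> straddle \<open>t\<close>, the two
      one-sided errors \<open>e * (t - p)\<close> and \<open>e * (q - t)\<close> add up to exactly
      \<open>e * (q - p)\<close>.\<close>
    have p: "\<bar>f p - f t - (p - t) * v\<bar> \<le> e * (t - p)" using *[of p] H by (simp add: dist_real_def)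
    have q: "\<bar>f q - f t - (q - t) * v\<bar> \<le> e * (q - t)" using *[of q] H by (simp add: dist_real_def)
    have "(q - p) * v \<le> 0" using H v by (simp add: mult_nonneg_nonpos)
    then show "f q - f p \<le> e * (q - p)" using p q by (simp add: algebra_simps abs_le_iff)
  qed
qed

text \<open>The definition numbers its intervals by natural numbers, whereas the pieces of a tagged
  division form a finite set; a bijection with an initial segment bridges the two.\<close>

lemma abs_cont_on_sum_finite:
  fixes f :: "real \<Rightarrow> 'a::real_normed_vector"
  assumes "abs_cont_on f a b" "e > 0"
  shows "\<exists>d>0. \<forall>(Q :: 'i set) l r. finite Q \<longrightarrow> (\<forall>i\<in>Q. a \<le> l i \<and> l i \<le> r i \<and> r i \<le> b) \<longrightarrow>
      (\<forall>i\<in>Q. \<forall>j\<in>Q. i \<noteq> j \<longrightarrow> r i \<le> l j \<or> r j \<le> l i) \<longrightarrow>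
      (\<Sum>i\<in>Q. r i - l i) < d \<longrightarrow> (\<Sum>i\<in>Q. norm (f (r i) - f (l i))) < e"
proof -
  obtain d where d: "d > 0" and
    *: "\<forall>(n::nat) l r. (\<forall>i<n. a \<le> l i \<and> l i \<le> r i \<and> r i \<le> b) \<and>
      (\<forall>i<n. \<forall>j<n. i \<noteq> j \<longrightarrow> r i \<le> l j \<or> r j \<le> l i) \<and>
      (\<Sum>i<n. r i - l i) < d \<longrightarrow> (\<Sum>i<n. norm (f (r i) - f (l i))) < e"
    using assms(1)[unfolded abs_cont_on_def, THEN spec, THEN mp, OF assms(2)]
    by (elim exE conjE) (rule that)
  show ?thesis
  proof (intro exI conjI allI impI)
    fix Q :: "'i set" and l r :: "'i \<Rightarrow> real"
    assume Q: "finite Q" and lr: "\<forall>i\<in>Q. a \<le> l i \<and> l i \<le> r i \<and> r i \<le> b"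
      and dj: "\<forall>i\<in>Q. \<forall>j\<in>Q. i \<noteq> j \<longrightarrow> r i \<le> l j \<or> r j \<le> l i"
      and s: "(\<Sum>i\<in>Q. r i - l i) < d"
    obtain g where g: "bij_betw g {..<card Q} Q"
      using ex_bij_betw_nat_finite[OF Q] by (auto simp: atLeast0LessThan)
    have inj: "g i \<noteq> g j" if "i < card Q" "j < card Q" "i \<noteq> j" for i j
      using g that by (auto simp: bij_betw_def inj_on_def)
    have mem: "g i \<in> Q" if "i < card Q" for i using g that by (auto simp: bij_betw_def)
    have "(\<Sum>i<card Q. norm (f (r (g i)) - f (l (g i)))) < e"
    proof (rule *[THEN spec[of _ "card Q"], THEN spec[of _ "\<lambda>i. l (g i)"], THEN spec[of _ "\<lambda>i. r (g i)"], THEN mp], intro conjI)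
      show "\<forall>i<card Q. a \<le> l (g i) \<and> l (g i) \<le> r (g i) \<and> r (g i) \<le> b" using mem lr by blast
      show "\<forall>i<card Q. \<forall>j<card Q. i \<noteq> j \<longrightarrow> r (g i) \<le> l (g j) \<or> r (g j) \<le> l (g i)"
        using mem dj inj by blast
      show "(\<Sum>i<card Q. r (g i) - l (g i)) < d"
        using s sum.reindex_bij_betw[OF g, of "\<lambda>i. r i - l i"] by simp
    qed
    then show "(\<Sum>i\<in>Q. norm (f (r i) - f (l i))) < e"
      using sum.reindex_bij_betw[OF g, of "\<lambda>i. norm (f (r i) - f (l i))"] by simp
  qed (fact d)
qed

text \<open>
  Cousin's lemma: near a point with nonpositive derivative the increment of \<open>f\<close> is at most \<open>\<epsilon>\<close> times
  the length, and the intervals tagged in the exceptional null set have small total length, so there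
  absolute continuity bounds the increments.
\<close>

lemma abs_cont_nonincreasing:
  fixes f :: "real \<Rightarrow> real"
  assumes ac: "abs_cont_on f a b" and ab: "a \<le> b"
    and der: "AE t in lebesgue. t \<in> {a..b} \<longrightarrow> (\<exists>v\<le>0. (f has_vector_derivative v) (at t within {a..b}))"
  shows "f b \<le> f a"
proof -
  have key: "f b - f a \<le> e + e * (b - a)" if e: "e > 0" for e
  proof -
    obtain \<delta> where \<delta>: "\<delta> > 0" and ac': "\<forall>(Q :: (real \<times> real set) set) l r. finite Q \<longrightarrow>
      (\<forall>i\<in>Q. a \<le> l i \<and> l i \<le> r i \<and> r i \<le> b) \<longrightarrow>
      (\<forall>i\<in>Q. \<forall>j\<in>Q. i \<noteq> j \<longrightarrow> r i \<le> l j \<or> r j \<le> l i) \<longrightarrow>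
      (\<Sum>i\<in>Q. r i - l i) < \<delta> \<longrightarrow> (\<Sum>i\<in>Q. norm (f (r i) - f (l i))) < e"
      using abs_cont_on_sum_finite[OF ac e] by (elim exE conjE) (rule that)
    obtain N where "N \<in> null_sets lebesgue"
      and N: "\<And>t. t \<in> {a..b} - N \<Longrightarrow> \<exists>v\<le>0. (f has_vector_derivative v) (at t within {a..b})"
      using der unfolding eventually_ae_filter by (auto simp: subset_iff) metis
    then have "N \<in> sets lebesgue" by auto
    then obtain U where U: "open U" "N \<subseteq> U" and "emeasure lebesgue (U - N) < ennreal \<delta>"
      using sets_lebesgue_outer_open[OF _ \<delta>] by metis
    then have emU: "emeasure lebesgue U < ennreal \<delta>"
      using emeasure_Diff_null_set[OF \<open>N \<in> null_sets lebesgue\<close>, of U] by simp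
    have Um: "U \<in> lmeasurable"
      using emU U(1) by (auto simp: fmeasurable_def less_top[symmetric])
    moreover have "measure lebesgue U < \<delta>"
      using emU \<delta> by (metis Um emeasure_eq_measure2 ennreal_less_iff measure_nonneg)
    ultimately have U: "open U" "N \<subseteq> U" "U \<in> lmeasurable" "measure lebesgue U < \<delta>" using U by auto
    have "\<exists>d>0. t \<in> {a..b} - N \<longrightarrow> (\<forall>p q. p \<in> {a..b} \<longrightarrow> q \<in> {a..b} \<longrightarrow> p \<le> t \<longrightarrow> t \<le> q \<longrightarrow>
           p \<in> ball t d \<longrightarrow> q \<in> ball t d \<longrightarrow> f q - f p \<le> e * (q - p))" for t
    proof (cases "t \<in> {a..b} - N")
      case True
      then obtain v where "v \<le> 0" "(f has_vector_derivative v) (at t within {a..b})" using N by blast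
      then obtain d where "d > 0" "\<And>p q. p \<in> {a..b} \<Longrightarrow> q \<in> {a..b} \<Longrightarrow> p \<le> t \<Longrightarrow> t \<le> q \<Longrightarrow>
           p \<in> ball t d \<Longrightarrow> q \<in> ball t d \<Longrightarrow> f q - f p \<le> e * (q - p)"
        using vector_derivative_nonpos_local_bound[OF _ _ e] by metis
      then show ?thesis by (intro exI[of _ d]) simp
    qed (auto intro: exI[of _ 1])
    then obtain D where D0: "\<And>t. D t > 0" and D: "\<And>t p q. t \<in> {a..b} - N \<Longrightarrow> p \<in> {a..b} \<Longrightarrow> q \<in> {a..b} \<Longrightarrow>
       p \<le> t \<Longrightarrow> t \<le> q \<Longrightarrow> p \<in> ball t (D t) \<Longrightarrow> q \<in> ball t (D t) \<Longrightarrow> f q - f p \<le> e * (q - p)"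
      by metis
    \<comment> \<open>A tag in the null set gets the whole of \<open>U\<close> as its neighbourhood,
      so all pieces tagged in \<open>N\<close> lie in \<open>U\<close> and have total length below
      \<open>\<delta>\<close>; every other tag gets its straddle radius.\<close>
    define \<gamma> where "\<gamma> t = (if t \<in> N then U else ball t (D t))" for t
    have "gauge \<gamma>" unfolding gauge_def \<gamma>_def using U D0 by auto
    then obtain p where p: "p tagged_division_of {a..b}" and fine: "\<gamma> fine p"
      using fine_division_exists_real by blast
    have fin: "finite p" using p by blast
    have box: "\<exists>l r. K = {l..r} \<and> a \<le> l \<and> l \<le> x \<and> x \<le> r \<and> r \<le> b" if xK: "(x,K) \<in> p" for x K
    proof -
      obtain l r where K: "K = {l..r}" using tagged_division_ofD(4)[OF p xK] by auto
      moreover have "x \<in> K" "K \<subseteq> {a..b}" using tagged_division_ofD(2,3)[OF p xK] by auto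
      ultimately show ?thesis by (intro exI[of _ l] exI[of _ r]) auto
    qed
    \<comment> \<open>One-point pieces are left out: they may sit inside a longer piece, where
      disjointness of interiors does not order the endpoints. Their increment is zero
      anyway.\<close>
    define Q where "Q = {i \<in> p. fst i \<in> N \<and> Inf (snd i) < Sup (snd i)}"
    have Qp: "Q \<subseteq> p" "finite Q" using fin by (auto simp: Q_def)
    have Qtp: "Q tagged_partial_division_of {a..b}"
      using p Qp by (meson tagged_division_of tagged_partial_division_subset tagged_division_of_def)
    have Qbox: "\<exists>l r. K = {l..r} \<and> a \<le> l \<and> l < r \<and> r \<le> b" if xK: "(x,K) \<in> Q" for x K
    proof -
      obtain l r where "K = {l..r}" "a \<le> l" "l \<le> r" "r \<le> b" using box[of x K] xK Qp by force
      moreover have "Inf K < Sup K" using xK by (simp add: Q_def)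
      ultimately show ?thesis by (auto intro!: exI[of _ l] exI[of _ r])
    qed
    have Qdj: "Sup (snd i) \<le> Inf (snd j) \<or> Sup (snd j) \<le> Inf (snd i)" if ij: "i \<in> Q" "j \<in> Q" "i \<noteq> j" for i j
    proof -
      obtain x K where i: "i = (x,K)" by force
      obtain x' K' where j: "j = (x',K')" by force
      obtain l r where K: "K = {l..r}" "l < r" using Qbox ij(1) i by blast
      obtain l' r' where K': "K' = {l'..r'}" "l' < r'" using Qbox ij(2) j by blast
      have "interior K \<inter> interior K' = {}"
        using tagged_partial_division_ofD(5)[OF Qtp] ij i j by blast
      then have "{max l l'<..<min r r'} = {}" using K K' by (auto simp: interior_atLeastAtMost_real)
      then have "min r r' \<le> max l l'" by simp
      then show ?thesis using K K' i j by auto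
    qed
    have "inj_on snd Q"
    proof (rule inj_onI, rule ccontr)
      fix i j assume ij: "i \<in> Q" "j \<in> Q" "snd i = snd j" "i \<noteq> j"
      then have "Sup (snd i) \<le> Inf (snd i)" using Qdj by metis
      then show False using ij by (simp add: Q_def)
    qed
    then have "(\<Sum>i\<in>Q. Sup (snd i) - Inf (snd i)) = (\<Sum>K\<in>snd ` Q. Sup K - Inf K)"
      by (simp add: sum.reindex)
    also have "\<dots> = (\<Sum>K\<in>snd ` Q. measure lebesgue K)"
    proof (rule sum.cong[OF refl])
      fix K assume "K \<in> snd ` Q"
      then obtain l r where "K = {l..r}" "l < r" using Qbox by (metis imageE prod.collapse)
      then show "Sup K - Inf K = measure lebesgue K" by simp
    qed
    also have "\<dots> = measure lebesgue (\<Union>(snd ` Q))"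
      by (intro content_division partial_division_of_tagged_division[OF Qtp])
    also have "\<dots> \<le> measure lebesgue U"
    proof (rule measure_mono_fmeasurable)
      show "\<Union>(snd ` Q) \<subseteq> U" using fine Qp by (force simp: fine_def Q_def \<gamma>_def)
      show "\<Union>(snd ` Q) \<in> sets lebesgue"
      proof (rule sets.finite_Union)
        show "snd ` Q \<subseteq> sets lebesgue"
        proof
          fix K assume "K \<in> snd ` Q"
          then obtain l r where "K = {l..r}" using Qbox by (metis imageE prod.collapse)
          then show "K \<in> sets lebesgue" by simp
        qed
      qed (use Qp in auto)
    qed (use U in auto)
    also have "\<dots> < \<delta>" by fact
    finally have small: "(\<Sum>i\<in>Q. Sup (snd i) - Inf (snd i)) < \<delta>" .
    have "(\<Sum>i\<in>Q. norm (f (Sup (snd i)) - f (Inf (snd i)))) < e"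
    proof (rule ac'[rule_format, OF Qp(2) _ _ small])
      fix i assume "i \<in> Q"
      then obtain l r where "snd i = {l..r}" "a \<le> l" "l < r" "r \<le> b"
        using Qbox[of "fst i" "snd i"] by auto
      then show "a \<le> Inf (snd i) \<and> Inf (snd i) \<le> Sup (snd i) \<and> Sup (snd i) \<le> b" by simp
    qed (use Qdj in blast)
    then have 1: "(\<Sum>i\<in>Q. f (Sup (snd i)) - f (Inf (snd i))) \<le> e"
      using sum_mono[of Q "\<lambda>i. f (Sup (snd i)) - f (Inf (snd i))" "\<lambda>i. norm (f (Sup (snd i)) - f (Inf (snd i)))"]
      by fastforce
    have "(\<Sum>i\<in>p - Q. f (Sup (snd i)) - f (Inf (snd i))) \<le> (\<Sum>i\<in>p - Q. e * (Sup (snd i) - Inf (snd i)))"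
    proof (rule sum_mono)
      fix i assume i: "i \<in> p - Q"
      obtain x K where xK: "i = (x,K)" by force
      obtain l r where K: "K = {l..r}" "a \<le> l" "l \<le> x" "x \<le> r" "r \<le> b" using box i xK by blast
      show "f (Sup (snd i)) - f (Inf (snd i)) \<le> e * (Sup (snd i) - Inf (snd i))"
      proof (cases "x \<in> N")
        case True
        then have "l = r" using i xK K by (auto simp: Q_def)
        then show ?thesis using xK K by simp
      next
        case False
        moreover have "(x,K) \<in> p" using i xK by simp
        ultimately have KD: "K \<subseteq> ball x (D x)" using fine unfolding fine_def \<gamma>_def by fastforce
        have "l \<in> K" "r \<in> K" using K by auto
        then have "l \<in> ball x (D x)" "r \<in> ball x (D x)" using KD by blast+
        then have "f r - f l \<le> e * (r - l)" using D[of x l r] False K by auto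
        then show ?thesis using K xK by simp
      qed
    qed
    also have "\<dots> \<le> (\<Sum>i\<in>p. e * (Sup (snd i) - Inf (snd i)))"
    proof (rule sum_mono2[OF fin])
      fix i assume "i \<in> p - (p - Q)"
      then show "0 \<le> e * (Sup (snd i) - Inf (snd i))" using e by (auto simp: Q_def)
    qed auto
    also have "\<dots> = e * (\<Sum>(x,K)\<in>p. Sup K - Inf K)" by (simp add: sum_distrib_left case_prod_unfold)
    also have "\<dots> = e * (b - a)" using additive_tagged_division_1[OF ab p, of "\<lambda>x. x"] by simp
    finally have 2: "(\<Sum>i\<in>p - Q. f (Sup (snd i)) - f (Inf (snd i))) \<le> e * (b - a)" .
    have "f b - f a = (\<Sum>i\<in>p. f (Sup (snd i)) - f (Inf (snd i)))"
      using additive_tagged_division_1[OF ab p, of f] by (simp add: case_prod_unfold)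
    also have "\<dots> = (\<Sum>i\<in>p - Q. f (Sup (snd i)) - f (Inf (snd i))) + (\<Sum>i\<in>Q. f (Sup (snd i)) - f (Inf (snd i)))"
      using Qp fin by (simp add: sum.subset_diff)
    finally show ?thesis using 1 2 by linarith
  qed
  have "f b - f a \<le> 0"
  proof (rule field_le_epsilon)
    fix e :: real assume e: "e > 0"
    \<comment> \<open>With \<open>e / (1 + b - a)\<close> the bound of \<open>key\<close> becomes
      \<open>e\<close>; the \<open>1\<close> also covers \<open>a = b\<close>.\<close>
    have "f b - f a \<le> e / (1 + b - a) * (1 + (b - a))"
      using key[of "e / (1 + b - a)"] e ab by (simp add: distrib_left)
    also have "\<dots> = e" using ab by (simp add: field_simps)
    finally show "f b - f a \<le> 0 + e" by simp
  qed
  then show ?thesis by simp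
qed

text \<open>\<open>C = 0\<close> gives Lipschitz functions, \<open>D = 0\<close> Lipschitz images of
  \<open>f\<close>, and the general case the weighted square in Gronwall's inequality.\<close>

lemma abs_cont_on_dominated:
  fixes f :: "real \<Rightarrow> 'a::real_normed_vector" and g :: "real \<Rightarrow> 'b::real_normed_vector"
  assumes f: "abs_cont_on f a b" and C: "C \<ge> 0" and D: "D \<ge> 0"
    and le: "\<And>s t. a \<le> s \<Longrightarrow> s \<le> t \<Longrightarrow> t \<le> b \<Longrightarrow> norm (g t - g s) \<le> C * norm (f t - f s) + D * (t - s)"
  shows "abs_cont_on g a b"
  unfolding abs_cont_on_def
proof (intro allI impI)
  fix e :: real assume e: "e > 0"
  \<comment> \<open>Half of \<open>e\<close> goes to each of the two terms; \<open>C + 1\<close> and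
    \<open>D + 1\<close> keep the denominators positive when a constant is zero.\<close>
  have e': "e / (2 * (C + 1)) > 0" using e C by simp
  obtain d where d: "d > 0" and
    *: "\<forall>(n::nat) l r. (\<forall>i<n. a \<le> l i \<and> l i \<le> r i \<and> r i \<le> b) \<and>
      (\<forall>i<n. \<forall>j<n. i \<noteq> j \<longrightarrow> r i \<le> l j \<or> r j \<le> l i) \<and>
      (\<Sum>i<n. r i - l i) < d \<longrightarrow> (\<Sum>i<n. norm (f (r i) - f (l i))) < e / (2 * (C + 1))"
    using f[unfolded abs_cont_on_def, THEN spec, THEN mp, OF e'] by (elim exE conjE) (rule that)
  show "\<exists>d>0. \<forall>(n::nat) l r. (\<forall>i<n. a \<le> l i \<and> l i \<le> r i \<and> r i \<le> b) \<and>
      (\<forall>i<n. \<forall>j<n. i \<noteq> j \<longrightarrow> r i \<le> l j \<or> r j \<le> l i) \<and>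
      (\<Sum>i<n. r i - l i) < d \<longrightarrow> (\<Sum>i<n. norm (g (r i) - g (l i))) < e"
  proof (intro exI[of _ "min d (e / (2 * (D + 1)))"] conjI allI impI; (elim conjE)?)
    show "0 < min d (e / (2 * (D + 1)))" using d e D by simp
    fix n :: nat and l r :: "nat \<Rightarrow> real"
    assume lr: "\<forall>i<n. a \<le> l i \<and> l i \<le> r i \<and> r i \<le> b"
      and dj: "\<forall>i<n. \<forall>j<n. i \<noteq> j \<longrightarrow> r i \<le> l j \<or> r j \<le> l i"
      and s: "(\<Sum>i<n. r i - l i) < min d (e / (2 * (D + 1)))"
    have 1: "(\<Sum>i<n. norm (f (r i) - f (l i))) < e / (2 * (C + 1))"
      using *[THEN spec[of _ n], THEN spec[of _ l], THEN spec[of _ r], THEN mp] lr dj s by simp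
    have "(\<Sum>i<n. norm (g (r i) - g (l i))) \<le> (\<Sum>i<n. C * norm (f (r i) - f (l i)) + D * (r i - l i))"
      by (rule sum_mono) (use le lr in auto)
    also have "\<dots> = C * (\<Sum>i<n. norm (f (r i) - f (l i))) + D * (\<Sum>i<n. r i - l i)"
      by (simp only: sum.distrib sum_distrib_left)
    also have "\<dots> \<le> C * (e / (2 * (C + 1))) + D * (e / (2 * (D + 1)))"
      using 1 s C D by (intro add_mono mult_left_mono) auto
    also have "\<dots> < (C + 1) * (e / (2 * (C + 1))) + (D + 1) * (e / (2 * (D + 1)))"
      using e C D by (intro add_strict_mono mult_strict_right_mono) auto
    also have "\<dots> = e"
    proof -
      have "x * (e / (2 * x)) = e / 2" if "x > 0" for x :: real using that by simp
      from this[of "C + 1"] this[of "D + 1"] C D show ?thesis by linarith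
    qed
    finally show "(\<Sum>i<n. norm (g (r i) - g (l i))) < e" .
  qed
qed

lemma abs_cont_on_diff:
  fixes f g :: "real \<Rightarrow> 'a::real_normed_vector"
  assumes f: "abs_cont_on f a b" and g: "abs_cont_on g a b"
  shows "abs_cont_on (\<lambda>t. f t - g t) a b"
  unfolding abs_cont_on_def
proof (intro allI impI)
  fix e :: real assume "e > 0"
  then have e: "e / 2 > 0" by simp
  obtain d where d: "d > 0" and
    1: "\<forall>(n::nat) l r. (\<forall>i<n. a \<le> l i \<and> l i \<le> r i \<and> r i \<le> b) \<and>
      (\<forall>i<n. \<forall>j<n. i \<noteq> j \<longrightarrow> r i \<le> l j \<or> r j \<le> l i) \<and>
      (\<Sum>i<n. r i - l i) < d \<longrightarrow> (\<Sum>i<n. norm (f (r i) - f (l i))) < e / 2"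
    using f[unfolded abs_cont_on_def, THEN spec, THEN mp, OF e] by (elim exE conjE) (rule that)
  obtain d' where d': "d' > 0" and
    2: "\<forall>(n::nat) l r. (\<forall>i<n. a \<le> l i \<and> l i \<le> r i \<and> r i \<le> b) \<and>
      (\<forall>i<n. \<forall>j<n. i \<noteq> j \<longrightarrow> r i \<le> l j \<or> r j \<le> l i) \<and>
      (\<Sum>i<n. r i - l i) < d' \<longrightarrow> (\<Sum>i<n. norm (g (r i) - g (l i))) < e / 2"
    using g[unfolded abs_cont_on_def, THEN spec, THEN mp, OF e] by (elim exE conjE) (rule that)
  show "\<exists>d>0. \<forall>(n::nat) l r. (\<forall>i<n. a \<le> l i \<and> l i \<le> r i \<and> r i \<le> b) \<and>
      (\<forall>i<n. \<forall>j<n. i \<noteq> j \<longrightarrow> r i \<le> l j \<or> r j \<le> l i) \<and>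
      (\<Sum>i<n. r i - l i) < d \<longrightarrow> (\<Sum>i<n. norm ((f (r i) - g (r i)) - (f (l i) - g (l i)))) < e"
  proof (intro exI[of _ "min d d'"] conjI allI impI; (elim conjE)?)
    show "0 < min d d'" using d d' by simp
    fix n :: nat and l r :: "nat \<Rightarrow> real"
    assume lr: "\<forall>i<n. a \<le> l i \<and> l i \<le> r i \<and> r i \<le> b"
      and dj: "\<forall>i<n. \<forall>j<n. i \<noteq> j \<longrightarrow> r i \<le> l j \<or> r j \<le> l i"
      and s: "(\<Sum>i<n. r i - l i) < min d d'"
    have "(\<Sum>i<n. norm ((f (r i) - g (r i)) - (f (l i) - g (l i)))) \<le>
        (\<Sum>i<n. norm (f (r i) - f (l i)) + norm (g (r i) - g (l i)))"
    proof (rule sum_mono)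
      fix i
      have "(f (r i) - g (r i)) - (f (l i) - g (l i)) = (f (r i) - f (l i)) - (g (r i) - g (l i))" by simp
      then show "norm ((f (r i) - g (r i)) - (f (l i) - g (l i))) \<le> norm (f (r i) - f (l i)) + norm (g (r i) - g (l i))"
        by (metis norm_triangle_ineq4)
    qed
    also have "\<dots> < e / 2 + e / 2" unfolding sum.distrib
      using 1[THEN spec[of _ n], THEN spec[of _ l], THEN spec[of _ r], THEN mp]
        2[THEN spec[of _ n], THEN spec[of _ l], THEN spec[of _ r], THEN mp] lr dj s
      by (intro add_strict_mono) simp_all
    finally show "(\<Sum>i<n. norm ((f (r i) - g (r i)) - (f (l i) - g (l i)))) < e" by simp
  qed
qed

lemma abs_cont_on_imp_continuous_on:
  fixes f :: "real \<Rightarrow> 'a::real_normed_vector"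
  assumes "abs_cont_on f a b"
  shows "continuous_on {a..b} f"
  unfolding continuous_on_iff
proof (intro ballI allI impI)
  fix x e :: real assume x: "x \<in> {a..b}" and e: "e > 0"
  obtain d where d: "d > 0" and
    1: "\<forall>(n::nat) l r. (\<forall>i<n. a \<le> l i \<and> l i \<le> r i \<and> r i \<le> b) \<and>
      (\<forall>i<n. \<forall>j<n. i \<noteq> j \<longrightarrow> r i \<le> l j \<or> r j \<le> l i) \<and>
      (\<Sum>i<n. r i - l i) < d \<longrightarrow> (\<Sum>i<n. norm (f (r i) - f (l i))) < e"
    using assms[unfolded abs_cont_on_def, THEN spec, THEN mp, OF e] by (elim exE conjE) (rule that)
  have "norm (f q - f p) < e" if "a \<le> p" "p \<le> q" "q \<le> b" "q - p < d" for p q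
    using 1[THEN spec[of _ 1], THEN spec[of _ "\<lambda>_. p"], THEN spec[of _ "\<lambda>_. q"], THEN mp] that by simp
  note * = this
  have "dist (f y) (f x) < e" if "y \<in> {a..b}" "dist y x < d" for y
  proof (cases "x \<le> y")
    case True
    then show ?thesis using *[of x y] that x by (auto simp: dist_norm)
  next
    case False
    then show ?thesis using *[of y x] that x by (auto simp: dist_norm norm_minus_commute)
  qed
  then show "\<exists>d>0. \<forall>x'\<in>{a..b}. dist x' x < d \<longrightarrow> dist (f x') (f x) < e" using d by blast
qed

lemma abs_cont_on_subinterval:
  assumes "abs_cont_on f a b" "a \<le> a'" "b' \<le> b"
  shows "abs_cont_on f a' b'"
  unfolding abs_cont_on_def
proof (intro allI impI)
  fix e :: real assume e: "e > 0"
  obtain d where d: "d > 0" and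
    1: "\<forall>(n::nat) l r. (\<forall>i<n. a \<le> l i \<and> l i \<le> r i \<and> r i \<le> b) \<and>
      (\<forall>i<n. \<forall>j<n. i \<noteq> j \<longrightarrow> r i \<le> l j \<or> r j \<le> l i) \<and>
      (\<Sum>i<n. r i - l i) < d \<longrightarrow> (\<Sum>i<n. norm (f (r i) - f (l i))) < e"
    using assms(1)[unfolded abs_cont_on_def, THEN spec, THEN mp, OF e] by (elim exE conjE) (rule that)
  show "\<exists>d>0. \<forall>(n::nat) l r. (\<forall>i<n. a' \<le> l i \<and> l i \<le> r i \<and> r i \<le> b') \<and>
      (\<forall>i<n. \<forall>j<n. i \<noteq> j \<longrightarrow> r i \<le> l j \<or> r j \<le> l i) \<and>
      (\<Sum>i<n. r i - l i) < d \<longrightarrow> (\<Sum>i<n. norm (f (r i) - f (l i))) < e"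
  proof (intro exI[of _ d] conjI allI impI d; elim conjE)
    fix n :: nat and l r :: "nat \<Rightarrow> real"
    assume H: "\<forall>i<n. a' \<le> l i \<and> l i \<le> r i \<and> r i \<le> b'"
      "\<forall>i<n. \<forall>j<n. i \<noteq> j \<longrightarrow> r i \<le> l j \<or> r j \<le> l i" "(\<Sum>i<n. r i - l i) < d"
    have "\<forall>i<n. a \<le> l i \<and> l i \<le> r i \<and> r i \<le> b" using H(1) assms(2,3) by force
    then show "(\<Sum>i<n. norm (f (r i) - f (l i))) < e"
      using 1[THEN spec[of _ n], THEN spec[of _ l], THEN spec[of _ r], THEN mp] H by blast
  qed
qed

lemma lipschitz_imp_abs_cont_on:
  fixes f :: "real \<Rightarrow> 'a::real_normed_vector"
  assumes "C-lipschitz_on {a..b} f"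
  shows "abs_cont_on f a b"
proof (rule abs_cont_on_dominated[where C = 0 and D = C])
  show "abs_cont_on (\<lambda>_. 0::real) a b" by (auto simp: abs_cont_on_def intro: exI[of _ 1])
  show "C \<ge> 0" using assms by (simp add: lipschitz_on_def)
  show "norm (f t - f s) \<le> 0 * norm (0 - 0 :: real) + C * (t - s)" if "a \<le> s" "s \<le> t" "t \<le> b" for s t
    using lipschitz_onD[OF assms, of t s] that by (simp add: dist_norm)
qed simp

text \<open>After the last time at which \<open>w\<close> is nonpositive it is positive, hence
  nonincreasing, so it cannot have risen above its value at that time.\<close>

lemma abs_cont_barrier:
  fixes w :: "real \<Rightarrow> real"
  assumes ac: "abs_cont_on w 0 T" and T: "T \<ge> 0" and w0: "w 0 \<le> 0"
    and der: "AE t in lebesgue. t \<in> {0..T} \<longrightarrow> w t > 0 \<longrightarrow>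
      (\<exists>v\<le>0. (w has_vector_derivative v) (at t within {0..T}))"
  shows "w T \<le> 0"
proof (rule ccontr)
  assume wT: "\<not> w T \<le> 0"
  have cont: "continuous_on {0..T} w" by (rule abs_cont_on_imp_continuous_on[OF ac])
  define A where "A = {t \<in> {0..T}. w t \<le> 0}"
  have "closed A" unfolding A_def using continuous_closed_preimage[OF cont, of "{..0}"]
    by (simp add: vimage_def Int_def)
  moreover have A: "A \<noteq> {}" "bdd_above A" using T w0 by (auto simp: A_def intro: bdd_aboveI[of _ T])
  ultimately have "Sup A \<in> A" by (simp add: closed_contains_Sup)
  then have s: "0 \<le> Sup A" "Sup A \<le> T" "w (Sup A) \<le> 0" by (auto simp: A_def)
  have pos: "w t > 0" if "Sup A < t" "t \<le> T" for t
  proof (rule ccontr)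
    assume "\<not> w t > 0"
    then have "t \<in> A" using that s by (auto simp: A_def)
    then show False using cSup_upper[OF _ A(2)] that by fastforce
  qed
  have "w T \<le> w (Sup A)"
  proof (rule abs_cont_nonincreasing[OF abs_cont_on_subinterval[OF ac s(1)] s(2)])
    \<comment> \<open>At \<open>Sup A\<close> itself \<open>w\<close> is not positive, so the
      hypothesis is silent there; one point is a null set.\<close>
    have "{Sup A} \<in> null_sets lebesgue" by (simp add: negligible_iff_null_sets[symmetric])
    then have "AE t in lebesgue. t \<noteq> Sup A" using AE_not_in by fastforce
    then show "AE t in lebesgue. t \<in> {Sup A..T} \<longrightarrow> (\<exists>v\<le>0. (w has_vector_derivative v) (at t within {Sup A..T}))"
      using der
    proof eventually_elim
      fix t assume t: "t \<noteq> Sup A" "t \<in> {0..T} \<longrightarrow> w t > 0 \<longrightarrow> (\<exists>v\<le>0. (w has_vector_derivative v) (at t within {0..T}))"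
      show "t \<in> {Sup A..T} \<longrightarrow> (\<exists>v\<le>0. (w has_vector_derivative v) (at t within {Sup A..T}))"
      proof
        assume "t \<in> {Sup A..T}"
        then have "t \<in> {0..T}" "w t > 0" using t(1) s pos by auto
        then obtain v where "v \<le> 0" "(w has_vector_derivative v) (at t within {0..T})" using t(2) by blast
        moreover have "{Sup A..T} \<subseteq> {0..T}" using s by auto
        ultimately show "\<exists>v\<le>0. (w has_vector_derivative v) (at t within {Sup A..T})"
          using has_vector_derivative_within_subset by blast
      qed
    qed
  qed simp
  then show False using wT s by simp
qed

text \<open>A bound on \<open>v \<bullet> w t\<close>, rather than on \<open>norm v\<close>, is all
  that a discontinuous one-sided Lipschitz field provides. It controls the derivative of the squared
  norm, so with the weight \<open>exp (- (2 * K) * t)\<close> that square is nonincreasing.\<close>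

lemma abs_cont_gronwall:
  fixes w :: "real \<Rightarrow> 'a::real_inner"
  assumes ac: "abs_cont_on w 0 T" and T: "T \<ge> 0" and w0: "w 0 = 0" and K: "K \<ge> 0"
    and der: "AE t in lebesgue. t \<in> {0..T} \<longrightarrow>
      (\<exists>v. (w has_vector_derivative v) (at t within {0..T}) \<and> v \<bullet> w t \<le> K * (norm (w t))\<^sup>2)"
  shows "w T = 0"
proof -
  have "compact (w ` {0..T})"
    by (intro compact_continuous_image abs_cont_on_imp_continuous_on[OF ac] compact_Icc)
  then obtain B where B: "B > 0" "\<And>t. t \<in> {0..T} \<Longrightarrow> norm (w t) \<le> B"
    using compact_imp_bounded bounded_pos by (metis imageI)
  define f where "f t = exp (- (2 * K) * t) * (w t \<bullet> w t)" for t
  have "f T \<le> f 0"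
  proof (rule abs_cont_nonincreasing[OF _ T])
    show "abs_cont_on f 0 T"
    proof (rule abs_cont_on_dominated[OF ac])
      show "0 \<le> 2 * B" "0 \<le> B\<^sup>2 * (2 * K)" using B K by auto
      fix s t assume st: "0 \<le> s" "s \<le> t" "t \<le> T"
      \<comment> \<open>Absolute continuity of \<open>f\<close>: on \<open>{0..T}\<close> the
        squared norm varies by at most \<open>2 * B\<close> times the increment of \<open>w\<close>,
        and the exponential weight is \<open>2 * K\<close>-Lipschitz.\<close>
      have "w t \<bullet> w t - w s \<bullet> w s = (w t + w s) \<bullet> (w t - w s)"
        by (simp add: inner_diff_right inner_add_left inner_commute[of "w s" "w t"])
      then have "\<bar>w t \<bullet> w t - w s \<bullet> w s\<bar> \<le> norm (w t + w s) * norm (w t - w s)"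
        by (simp add: Cauchy_Schwarz_ineq2)
      also have "norm (w t + w s) \<le> 2 * B" using B(2)[of s] B(2)[of t] st norm_triangle_ineq[of "w t" "w s"] by auto
      finally have 1: "\<bar>w t \<bullet> w t - w s \<bullet> w s\<bar> \<le> 2 * B * norm (w t - w s)" by (simp add: mult_right_mono)
      have 2: "w s \<bullet> w s \<le> B\<^sup>2" using B(2)[of s] st by (simp add: power2_norm_eq_inner[symmetric] power_mono)
      let ?E = "\<lambda>t. exp (- (2 * K) * t)"
      have E1: "0 \<le> ?E t" "?E t \<le> 1" "?E s \<le> 1" using K st by auto
      have "?E t = ?E s * exp (- (2 * K * (t - s)))" by (simp add: exp_add[symmetric] algebra_simps)
      then have "?E s - ?E t = ?E s * (1 - exp (- (2 * K * (t - s))))" by (simp add: algebra_simps)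
      also have "\<dots> \<le> 1 * (2 * K * (t - s))"
        using exp_ge_add_one_self[of "- (2 * K * (t - s))"] E1 K st by (intro mult_mono) auto
      finally have 3: "?E s - ?E t \<le> 2 * K * (t - s)" by simp
      have 4: "?E t \<le> ?E s" using K st by (simp add: mult_left_mono)
      have "f t - f s = ?E t * (w t \<bullet> w t - w s \<bullet> w s) - (?E s - ?E t) * (w s \<bullet> w s)"
        by (simp add: f_def algebra_simps)
      then have "\<bar>f t - f s\<bar> \<le> \<bar>?E t * (w t \<bullet> w t - w s \<bullet> w s)\<bar> + \<bar>(?E s - ?E t) * (w s \<bullet> w s)\<bar>"
        by linarith
      also have "\<dots> = ?E t * \<bar>w t \<bullet> w t - w s \<bullet> w s\<bar> + (?E s - ?E t) * (w s \<bullet> w s)"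
        using 4 by (simp add: abs_mult)
      also have "\<dots> \<le> 1 * (2 * B * norm (w t - w s)) + (2 * K * (t - s)) * B\<^sup>2"
        using E1 1 2 3 4 K st by (intro add_mono mult_mono) auto
      finally show "norm (f t - f s) \<le> 2 * B * norm (w t - w s) + B\<^sup>2 * (2 * K) * (t - s)"
        by (simp add: algebra_simps)
    qed
    show "AE t in lebesgue. t \<in> {0..T} \<longrightarrow> (\<exists>v\<le>0. (f has_vector_derivative v) (at t within {0..T}))"
      using der
    proof eventually_elim
      fix t assume t: "t \<in> {0..T} \<longrightarrow>
        (\<exists>v. (w has_vector_derivative v) (at t within {0..T}) \<and> v \<bullet> w t \<le> K * (norm (w t))\<^sup>2)"
      show "t \<in> {0..T} \<longrightarrow> (\<exists>v\<le>0. (f has_vector_derivative v) (at t within {0..T}))"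
      proof
        assume "t \<in> {0..T}"
        then obtain v where v: "(w has_vector_derivative v) (at t within {0..T})" "v \<bullet> w t \<le> K * (norm (w t))\<^sup>2"
          using t by blast
        have 1: "((\<lambda>t. w t \<bullet> w t) has_vector_derivative (w t \<bullet> v + v \<bullet> w t)) (at t within {0..T})"
          using bounded_bilinear.has_vector_derivative[OF bounded_bilinear_inner v(1) v(1)] .
        have 2: "((\<lambda>t. exp (- (2 * K) * t)) has_vector_derivative (- (2 * K)) * exp (- (2 * K) * t)) (at t within {0..T})"
          unfolding has_real_derivative_iff_has_vector_derivative[symmetric]
          by (auto intro!: derivative_eq_intros)
        have "(f has_vector_derivative (exp (- (2 * K) * t) * (w t \<bullet> v + v \<bullet> w t) +
            (- (2 * K)) * exp (- (2 * K) * t) * (w t \<bullet> w t))) (at t within {0..T})"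
          unfolding f_def by (rule has_vector_derivative_mult[OF 2 1])
        moreover have "exp (- (2 * K) * t) * (w t \<bullet> v + v \<bullet> w t) + (- (2 * K)) * exp (- (2 * K) * t) * (w t \<bullet> w t)
          = exp (- (2 * K) * t) * (2 * (v \<bullet> w t - K * (norm (w t))\<^sup>2))"
          by (simp add: power2_norm_eq_inner inner_commute algebra_simps)
        moreover have "\<dots> \<le> 0" using v(2) by (intro mult_nonneg_nonpos) auto
        ultimately show "\<exists>v\<le>0. (f has_vector_derivative v) (at t within {0..T})" by metis
      qed
    qed
  qed
  then have "exp (- (2 * K) * T) * (w T \<bullet> w T) \<le> 0" by (simp add: f_def w0)
  then have "w T \<bullet> w T \<le> 0" by (simp add: mult_le_0_iff)
  then show ?thesis using inner_ge_zero[of "w T"] inner_eq_zero_iff[of "w T"] by linarith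
qed

section \<open>The Filippov map\<close>

text \<open>A closed half-space containing the field values near \<open>z\<close> contains their
  closed convex hull. As the bound holds on the whole ball, the member of the intersection with
  \<open>N = {}\<close> is enough.\<close>

lemma filippov_map_halfspace:
  assumes v: "v \<in> filippov_map F z" and d: "\<delta> > 0" and b: "\<And>p. p \<in> ball z \<delta> \<Longrightarrow> a \<bullet> F p \<le> b"
  shows "a \<bullet> v \<le> b"
proof -
  have "v \<in> closure (convex hull (F ` (ball z \<delta> - {})))"
    using v d unfolding filippov_map_def by blast
  also have "closure (convex hull (F ` (ball z \<delta> - {}))) \<subseteq> {x. a \<bullet> x \<le> b}"
    by (intro closure_minimal hull_minimal closed_halfspace_le convex_halfspace_le) (use b in auto)
  finally show ?thesis by simp
qed

lemma convex_filippov_map: "convex (filippov_map F z)"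
  unfolding filippov_map_def by (intro convex_INT convex_closure convex_convex_hull)

text \<open>Every neighbourhood of \<open>z\<close> meets \<open>U\<close> in a nonempty open set,
  which no null set can exhaust. So the limit at \<open>z\<close> of a continuous branch of the
  field survives all the intersections.\<close>

lemma filippov_map_limit:
  assumes U: "open U" and z: "z \<in> closure U" and eq: "\<And>p. p \<in> U \<Longrightarrow> F p = g p" and g: "isCont g z"
  shows "g z \<in> filippov_map F z"
proof -
  have "g z \<in> closure (convex hull (F ` (ball z \<delta> - N)))" if d: "\<delta> > 0" and N: "N \<in> null_sets lebesgue" for \<delta> N
  proof (rule subsetD[OF closure_mono[OF hull_subset]], unfold closure_approachable, intro allI impI)
    fix e :: real assume "e > 0"
    then obtain \<eta> where \<eta>: "\<eta> > 0" "\<And>p. dist p z < \<eta> \<Longrightarrow> dist (g p) (g z) < e"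
      using g unfolding continuous_at_eps_delta by (metis dist_norm)
    define W where "W = U \<inter> ball z (min \<delta> \<eta>)"
    have "open W" using U by (auto simp: W_def)
    moreover obtain u where "u \<in> U" "dist u z < min \<delta> \<eta>"
      using z d \<eta>(1) unfolding closure_approachable by (metis min_less_iff_conj)
    then have "W \<noteq> {}" by (auto simp: W_def dist_commute)
    ultimately have "\<not> W \<subseteq> N"
      using N open_not_negligible negligible_subset negligible_iff_null_sets by metis
    then obtain p where "p \<in> W" "p \<notin> N" by blast
    then have "p \<in> ball z \<delta> - N" "dist (F p) (g z) < e"
      using eq \<eta>(2)[of p] by (auto simp: W_def dist_commute)
    then show "\<exists>y\<in>F ` (ball z \<delta> - N). dist y (g z) < e" by blast
  qed
  then show ?thesis unfolding filippov_map_def by blast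
qed

lemma isCont_locally_bounded:
  fixes g :: "'a::metric_space \<Rightarrow> real"
  assumes "isCont g z"
  obtains \<delta> where "\<delta> > 0" "\<And>p. p \<in> ball z \<delta> \<Longrightarrow> \<bar>g p\<bar> \<le> \<bar>g z\<bar> + 1"
proof -
  obtain d where d: "d > 0" "\<And>p. dist p z < d \<Longrightarrow> dist (g p) (g z) < 1"
    using assms unfolding continuous_at_eps_delta by (metis dist_norm zero_less_one)
  show ?thesis
  proof (rule that[OF d(1)])
    fix p assume "p \<in> ball z d"
    then show "\<bar>g p\<bar> \<le> \<bar>g z\<bar> + 1" using d(2)[of p] by (simp add: dist_commute dist_real_def)
  qed
qed

lemma norm_field_le: "norm (field G H p) \<le> \<bar>G p\<bar> + \<bar>H p\<bar>"
proof -
  obtain x y where p: "p = (x,y)" by force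
  have *: "\<bar>snd (field G H p)\<bar> \<le> \<bar>H p\<bar>" "field G H p = (G p, 0) + (0, snd (field G H p))"
    by (auto simp: field_def p)
  have "norm ((G p, 0) + (0 :: real, snd (field G H p))) \<le> \<bar>G p\<bar> + \<bar>snd (field G H p)\<bar>"
    by (rule order_trans[OF norm_triangle_ineq]) simp
  then show ?thesis using * by simp
qed

text \<open>Read from \<open>y < 0\<close> upwards the branches are \<open>abs h\<close>,
  \<open>max h 0\<close>, \<open>h\<close>, \<open>min h 0\<close>, \<open>- abs h\<close>, with
  \<open>h\<close> the value of \<open>H\<close>: a nonincreasing list. Replacing the branch of
  \<open>p\<close> by that of \<open>q\<close> thus only raises the value, and within one branch the
  change from \<open>H p\<close> to \<open>H q\<close> costs at most its size.\<close>

lemma field_snd_diff_le: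
  assumes "snd q \<le> snd p"
  shows "snd (field G H p) - snd (field G H q) \<le> \<bar>H p - H q\<bar>"
proof -
  obtain x y where p: "p = (x,y)" by force
  obtain x' y' where q: "q = (x',y')" by force
  have "y' \<le> y" using assms p q by simp
  then show ?thesis unfolding p q field_def
    by (auto simp: abs_if)
qed

text \<open>Each coordinate contributes one \<open>L\<close>. In the second one the field jumps, so
  the difference of values has no small bound by itself; only its product with
  \<open>snd p - snd q\<close> has one.\<close>

lemma field_one_sided_lipschitz:
  assumes G: "L-lipschitz_on S G" and H: "L-lipschitz_on S H" and pq: "p \<in> S" "q \<in> S"
  shows "(field G H p - field G H q) \<bullet> (p - q) \<le> 2 * L * (norm (p - q))\<^sup>2"
proof -
  let ?F = "field G H"
  have L: "L \<ge> 0" using G by (simp add: lipschitz_on_def)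
  have n: "\<bar>fst p - fst q\<bar> \<le> norm (p - q)" "\<bar>snd p - snd q\<bar> \<le> norm (p - q)"
    using norm_fst_le[of "fst (p-q)" "snd (p-q)"] norm_snd_le[of "snd (p-q)" "fst (p-q)"]
    unfolding prod.collapse by auto
  have "\<bar>G p - G q\<bar> \<le> L * norm (p - q)" "\<bar>H p - H q\<bar> \<le> L * norm (p - q)"
    using lipschitz_onD[OF G pq] lipschitz_onD[OF H pq] by (auto simp: dist_norm)
  note GH = this
  have fst: "fst (?F p) = G p" "fst (?F q) = G q" by (auto simp: field_def case_prod_unfold)
  have "(G p - G q) * (fst p - fst q) \<le> \<bar>G p - G q\<bar> * \<bar>fst p - fst q\<bar>"
    by (metis abs_ge_self abs_mult)
  also have "\<dots> \<le> (L * norm (p - q)) * norm (p - q)" using GH n by (intro mult_mono) auto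
  finally have 1: "(G p - G q) * (fst p - fst q) \<le> L * (norm (p - q))\<^sup>2" by (simp add: power2_eq_square)
  have "(snd (?F p) - snd (?F q)) * (snd p - snd q) \<le> \<bar>H p - H q\<bar> * \<bar>snd p - snd q\<bar>"
  proof (cases "snd q \<le> snd p")
    case True
    then show ?thesis using field_snd_diff_le[OF True, of G H] by (auto intro: mult_right_mono)
  next
    case False
    then have "snd (?F q) - snd (?F p) \<le> \<bar>H p - H q\<bar>" using field_snd_diff_le[of p q G H] by auto
    then have "(snd (?F q) - snd (?F p)) * (snd q - snd p) \<le> \<bar>H p - H q\<bar> * (snd q - snd p)"
      using False by (intro mult_right_mono) auto
    then show ?thesis using False by (simp add: algebra_simps)
  qed
  also have "\<dots> \<le> (L * norm (p - q)) * norm (p - q)" using GH n by (intro mult_mono) auto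
  finally have 2: "(snd (?F p) - snd (?F q)) * (snd p - snd q) \<le> L * (norm (p - q))\<^sup>2"
    by (simp add: power2_eq_square)
  show ?thesis using 1 2 by (simp add: inner_prod_def fst)
qed

text \<open>The estimate for the field involves \<open>p - q\<close>, while a half-space has the
  fixed normal \<open>z1 - z2\<close>. On balls of radius \<open>\<delta>\<close> the two differ by
  at most \<open>2 * \<delta>\<close>, and local boundedness of the field turns this into an error
  that vanishes with \<open>\<delta>\<close>; hence the slack \<open>e\<close>.\<close>

lemma filippov_map_one_sided_lipschitz:
  assumes G: "L-lipschitz_on (ball 0 R) G" and H: "L-lipschitz_on (ball 0 R) H"
    and z: "z1 \<in> ball 0 R" "z2 \<in> ball 0 R"
    and v: "v1 \<in> filippov_map (field G H) z1" "v2 \<in> filippov_map (field G H) z2"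
  shows "(v1 - v2) \<bullet> (z1 - z2) \<le> 2 * L * (norm (z1 - z2))\<^sup>2"
proof (rule field_le_epsilon)
  fix e :: real assume e: "e > 0"
  let ?F = "field G H"
  have "isCont G z" "isCont H z" if "z \<in> ball 0 R" for z
    using G H that lipschitz_on_continuous_on continuous_on_eq_continuous_at open_ball by metis+
  note cont = this
  have "\<exists>d>0. \<exists>B. \<forall>p\<in>ball z d. norm (?F p) \<le> B" if z: "z \<in> ball 0 R" for z
  proof -
    obtain d1 where d1: "d1 > 0" "\<And>p. p \<in> ball z d1 \<Longrightarrow> \<bar>G p\<bar> \<le> \<bar>G z\<bar> + 1"
      using isCont_locally_bounded[OF cont(1)[OF z]] by metis
    obtain d2 where d2: "d2 > 0" "\<And>p. p \<in> ball z d2 \<Longrightarrow> \<bar>H p\<bar> \<le> \<bar>H z\<bar> + 1"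
      using isCont_locally_bounded[OF cont(2)[OF z]] by metis
    have "norm (?F p) \<le> (\<bar>G z\<bar> + 1) + (\<bar>H z\<bar> + 1)" if "p \<in> ball z (min d1 d2)" for p
      using d1(2)[of p] d2(2)[of p] norm_field_le[of G H p] that by auto
    then show ?thesis using d1(1) d2(1) by (intro exI[of _ "min d1 d2"] conjI exI[of _ "(\<bar>G z\<bar> + 1) + (\<bar>H z\<bar> + 1)"]) auto
  qed
  note bd = this
  obtain d1 B1 where d1: "d1 > 0" "\<And>p. p \<in> ball z1 d1 \<Longrightarrow> norm (?F p) \<le> B1" using bd[OF z(1)] by blast
  obtain d2 B2 where d2: "d2 > 0" "\<And>p. p \<in> ball z2 d2 \<Longrightarrow> norm (?F p) \<le> B2" using bd[OF z(2)] by blast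
  note d = d1(1) d2(1) and B = d1(2) d2(2)
  define B where "B = B1 + B2"
  have B0: "B \<ge> 0" using order_trans[OF norm_ge_zero B(1)[of z1]] order_trans[OF norm_ge_zero B(2)[of z2]] d
    by (simp add: B_def)
  have "isCont (\<lambda>\<delta>. 2 * L * (norm (z1 - z2) + 2 * \<delta>)\<^sup>2 + B * (2 * \<delta>)) 0" by (intro continuous_intros)
  then obtain \<delta>0 where \<delta>0: "\<delta>0 > 0" and \<delta>0': "\<And>\<delta>. \<bar>\<delta>\<bar> < \<delta>0 \<Longrightarrow>
      \<bar>2 * L * (norm (z1 - z2) + 2 * \<delta>)\<^sup>2 + B * (2 * \<delta>) - 2 * L * (norm (z1 - z2))\<^sup>2\<bar> < e"
    using e unfolding continuous_at_eps_delta dist_real_def by simp metis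
  obtain r1 where r1: "r1 > 0" "ball z1 r1 \<subseteq> ball 0 R" using z(1) by (meson open_ball open_contains_ball)
  obtain r2 where r2: "r2 > 0" "ball z2 r2 \<subseteq> ball 0 R" using z(2) by (meson open_ball open_contains_ball)
  define \<delta> where "\<delta> = Min {\<delta>0/2, d1, d2, r1, r2}"
  have \<delta>: "\<delta> > 0" "\<delta> \<le> \<delta>0/2" "\<delta> \<le> d1" "\<delta> \<le> d2" "\<delta> \<le> r1" "\<delta> \<le> r2"
    using \<delta>0 d r1 r2 by (auto simp: \<delta>_def)
  let ?c = "2 * L * (norm (z1 - z2))\<^sup>2 + e"
  have L: "L \<ge> 0" using G by (simp add: lipschitz_on_def)
  have *: "(z1 - z2) \<bullet> ?F p - (z1 - z2) \<bullet> ?F q \<le> ?c" if pq: "p \<in> ball z1 \<delta>" "q \<in> ball z2 \<delta>" for p q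
  proof -
    have m: "p \<in> ball 0 R" "q \<in> ball 0 R" "p \<in> ball z1 d1" "q \<in> ball z2 d2"
      using pq \<delta> subsetD[OF r1(2), of p] subsetD[OF r2(2), of q] by (auto simp del: mem_ball_0)
    have "norm ((z1 - z2) - (p - q)) = norm ((z1 - p) - (z2 - q))" by (simp add: algebra_simps)
    also have "\<dots> \<le> norm (z1 - p) + norm (z2 - q)" by (rule norm_triangle_ineq4)
    also have "\<dots> \<le> 2 * \<delta>" using pq by (simp add: dist_norm)
    finally have n: "norm ((z1 - z2) - (p - q)) \<le> 2 * \<delta>" .
    then have n': "norm (p - q) \<le> norm (z1 - z2) + 2 * \<delta>"
      using norm_triangle_sub[of "p - q" "z1 - z2"] norm_minus_commute[of "p - q" "z1 - z2"] by linarith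
    have "norm (?F p - ?F q) \<le> B" using B m norm_triangle_ineq4[of "?F p" "?F q"] by (fastforce simp: B_def)
    then have "(?F p - ?F q) \<bullet> ((z1 - z2) - (p - q)) \<le> B * (2 * \<delta>)"
      using n B0 by (meson mult_mono norm_cauchy_schwarz norm_ge_zero order_trans)
    moreover have "(?F p - ?F q) \<bullet> (p - q) \<le> 2 * L * (norm (z1 - z2) + 2 * \<delta>)\<^sup>2"
      using order_trans[OF field_one_sided_lipschitz[OF G H m(1,2)] mult_left_mono[OF power_mono[OF n']]] L by simp
    ultimately have "(?F p - ?F q) \<bullet> (z1 - z2) \<le> 2 * L * (norm (z1 - z2) + 2 * \<delta>)\<^sup>2 + B * (2 * \<delta>)"
      by (simp add: inner_diff_right)
    also have "\<dots> \<le> ?c" using \<delta>0'[of \<delta>] \<delta> \<delta>0 by linarith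
    finally show ?thesis by (simp add: inner_diff_left inner_commute inner_diff_right)
  qed
  \<comment> \<open>The two hulls are treated one at a time: here \<open>q\<close> is frozen and
    \<open>p\<close> ranges over its ball; afterwards \<open>v1\<close> is frozen and
    \<open>q\<close> ranges over its own ball.\<close>
  have 1: "(z1 - z2) \<bullet> v1 \<le> (z1 - z2) \<bullet> ?F q + ?c" if q: "q \<in> ball z2 \<delta>" for q
    by (rule filippov_map_halfspace[OF v(1) \<delta>(1)]) (use *[OF _ q] in force)
  have "(- (z1 - z2)) \<bullet> v2 \<le> ?c - (z1 - z2) \<bullet> v1"
    by (rule filippov_map_halfspace[OF v(2) \<delta>(1)]) (use 1 in \<open>force simp: inner_diff_left\<close>)
  then show "(v1 - v2) \<bullet> (z1 - z2) \<le> 2 * L * (norm (z1 - z2))\<^sup>2 + e"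
    by (simp add: inner_diff_left inner_commute inner_diff_right)
qed

section \<open>Uniqueness and invariance\<close>

lemma C1_plane_lipschitz_on_cball:
  assumes "C1_plane f"
  obtains L where "L-lipschitz_on (cball 0 R) f"
proof -
  obtain f' where f': "\<And>z. (f has_derivative blinfun_apply (f' z)) (at z)" and c: "continuous_on UNIV f'"
    using assms unfolding C1_plane_def by blast
  have "compact (f' ` cball 0 R)"
    by (intro compact_continuous_image continuous_on_subset[OF c] compact_cball) auto
  then obtain B where B: "B > 0" "\<And>z. z \<in> cball 0 R \<Longrightarrow> norm (f' z) \<le> B"
    using compact_imp_bounded bounded_pos by (metis imageI)
  have "B-lipschitz_on (cball 0 R) f"
  proof (rule bounded_derivative_imp_lipschitz)
    show "(f has_derivative blinfun_apply (f' z)) (at z within cball 0 R)" for z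
      using f' by (rule has_derivative_at_withinI)
    show "onorm (blinfun_apply (f' z)) \<le> B" if "z \<in> cball 0 R" for z
      using B(2)[OF that] by (simp add: norm_blinfun.rep_eq)
  qed (use B in auto)
  then show ?thesis by (rule that)
qed

lemma C1_plane_common_lipschitz_on_cball:
  assumes "C1_plane G" "C1_plane H"
  obtains L where "L-lipschitz_on (cball 0 R) G" "L-lipschitz_on (cball 0 R) H"
proof -
  obtain L1 L2 where "L1-lipschitz_on (cball 0 R) G" "L2-lipschitz_on (cball 0 R) H"
    using C1_plane_lipschitz_on_cball assms by metis
  then have "(max L1 L2)-lipschitz_on (cball 0 R) G" "(max L1 L2)-lipschitz_on (cball 0 R) H"
    by (auto intro: lipschitz_on_le)
  then show ?thesis by (rule that)
qed

lemma C1_plane_isCont: "C1_plane f \<Longrightarrow> isCont f z"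
  unfolding C1_plane_def using has_derivative_continuous by blast

lemma filippov_solution_abs_cont_on:
  assumes "filippov_solution F z I" "0 \<in> I" "t \<in> I" "0 \<le> t"
  shows "{0..t} \<subseteq> I" "abs_cont_on z 0 t"
proof -
  show 1: "{0..t} \<subseteq> I" using assms unfolding filippov_solution_def is_interval_1
    by (meson atLeastAtMost_iff subsetI)
  then show "abs_cont_on z 0 t" using assms unfolding filippov_solution_def loc_abs_cont_on_def by blast
qed

lemma filippov_solution_AE:
  assumes "filippov_solution F z I" "J \<subseteq> I"
  shows "AE t in lebesgue. t \<in> J \<longrightarrow>
    (\<exists>v. (z has_vector_derivative v) (at t within J) \<and> v \<in> filippov_map F (z t))"
proof -
  have "AE t in lebesgue. t \<in> I \<longrightarrow>
    (\<exists>v. (z has_vector_derivative v) (at t within I) \<and> v \<in> filippov_map F (z t))"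
    using assms by (simp add: filippov_solution_def)
  then show ?thesis
    by eventually_elim (use assms(2) in \<open>blast intro: has_vector_derivative_within_subset\<close>)
qed

lemma filippov_solution_unique:
  assumes GH: "C1_plane G" "C1_plane H"
    and sol: "filippov_solution (field G H) z1 I1" "filippov_solution (field G H) z2 I2"
    and I: "0 \<in> I1" "0 \<in> I2" and eq: "z1 0 = z2 0" and t: "t \<in> I1" "t \<in> I2" "0 \<le> t"
  shows "z1 t = z2 t"
proof -
  note s1 = filippov_solution_abs_cont_on[OF sol(1) I(1) t(1,3)]
  note s2 = filippov_solution_abs_cont_on[OF sol(2) I(2) t(2,3)]
  \<comment> \<open>One ball containing both curves up to time \<open>t\<close> supplies a common
    Lipschitz constant.\<close>
  have "compact (z1 ` {0..t} \<union> z2 ` {0..t})"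
    using s1 s2 by (intro compact_Un compact_continuous_image abs_cont_on_imp_continuous_on compact_Icc)
  then obtain R where R: "z1 ` {0..t} \<union> z2 ` {0..t} \<subseteq> ball 0 R"
    using compact_imp_bounded bounded_subset_ballD by blast
  obtain L where "L-lipschitz_on (cball 0 R) G" "L-lipschitz_on (cball 0 R) H"
    using C1_plane_common_lipschitz_on_cball[OF GH] by metis
  then have L: "L-lipschitz_on (ball 0 R) G" "L-lipschitz_on (ball 0 R) H"
    by (auto intro: lipschitz_on_subset)
  have "z1 t - z2 t = 0"
  proof (rule abs_cont_gronwall[OF abs_cont_on_diff[OF s1(2) s2(2)] t(3)])
    show "0 \<le> 2 * L" using L by (simp add: lipschitz_on_def)
    show "AE s in lebesgue. s \<in> {0..t} \<longrightarrow> (\<exists>v. ((\<lambda>s. z1 s - z2 s) has_vector_derivative v) (at s within {0..t})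
        \<and> v \<bullet> (z1 s - z2 s) \<le> 2 * L * (norm (z1 s - z2 s))\<^sup>2)"
      using filippov_solution_AE[OF sol(1) s1(1)] filippov_solution_AE[OF sol(2) s2(1)]
    proof eventually_elim
      fix s
      assume 1: "s \<in> {0..t} \<longrightarrow> (\<exists>v. (z1 has_vector_derivative v) (at s within {0..t}) \<and> v \<in> filippov_map (field G H) (z1 s))"
        and 2: "s \<in> {0..t} \<longrightarrow> (\<exists>v. (z2 has_vector_derivative v) (at s within {0..t}) \<and> v \<in> filippov_map (field G H) (z2 s))"
      show "s \<in> {0..t} \<longrightarrow> (\<exists>v. ((\<lambda>s. z1 s - z2 s) has_vector_derivative v) (at s within {0..t})
        \<and> v \<bullet> (z1 s - z2 s) \<le> 2 * L * (norm (z1 s - z2 s))\<^sup>2)"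
      proof
        assume s: "s \<in> {0..t}"
        obtain v1 where v1: "(z1 has_vector_derivative v1) (at s within {0..t})" "v1 \<in> filippov_map (field G H) (z1 s)"
          using 1 s by blast
        obtain v2 where v2: "(z2 has_vector_derivative v2) (at s within {0..t})" "v2 \<in> filippov_map (field G H) (z2 s)"
          using 2 s by blast
        have "z1 s \<in> ball 0 R" "z2 s \<in> ball 0 R" using R s by blast+
        then have "(v1 - v2) \<bullet> (z1 s - z2 s) \<le> 2 * L * (norm (z1 s - z2 s))\<^sup>2"
          using filippov_map_one_sided_lipschitz[OF L _ _ v1(2) v2(2)] by simp
        then show "\<exists>v. ((\<lambda>s. z1 s - z2 s) has_vector_derivative v) (at s within {0..t})
          \<and> v \<bullet> (z1 s - z2 s) \<le> 2 * L * (norm (z1 s - z2 s))\<^sup>2"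
          using has_vector_derivative_diff[OF v1(1) v2(1)] by blast
      qed
    qed
  qed (simp add: eq)
  then show ?thesis by simp
qed

section \<open>Forward invariance of the strip\<close>

lemma dist_snd_less:
  fixes p z :: "real \<times> real"
  assumes "p \<in> ball z d"
  shows "\<bar>snd p - snd z\<bar> < d"
  using le_less_trans[OF dist_snd_le[of z p]] assms by (simp add: dist_real_def abs_minus_commute)

lemma filippov_map_above:
  assumes "snd z > 1" "v \<in> filippov_map (field G H) z"
  shows "snd v \<le> 0"
proof -
  have "(0, 1) \<bullet> v \<le> 0"
  proof (rule filippov_map_halfspace[OF assms(2), of "snd z - 1"])
    fix p assume "p \<in> ball z (snd z - 1)"
    then have "snd p > 1" using dist_snd_less[of p z "snd z - 1"] by auto
    then show "(0, 1) \<bullet> field G H p \<le> 0" by (simp add: field_def case_prod_unfold)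
  qed (use assms in simp)
  then show ?thesis by (simp add: inner_prod_def)
qed

lemma filippov_map_below:
  assumes "snd z < 0" "v \<in> filippov_map (field G H) z"
  shows "snd v \<ge> 0"
proof -
  have "(0, -1) \<bullet> v \<le> 0"
  proof (rule filippov_map_halfspace[OF assms(2), of "- snd z"])
    fix p assume "p \<in> ball z (- snd z)"
    then have "snd p < 0" using dist_snd_less[of p z "- snd z"] by auto
    then show "(0, -1) \<bullet> field G H p \<le> 0" by (simp add: field_def case_prod_unfold)
  qed (use assms in simp)
  then show ?thesis by (simp add: inner_prod_def)
qed

lemma filippov_solution_strip_invariant:
  assumes sol: "filippov_solution (field G H) z I" and I: "0 \<in> I" and t: "t \<in> I" "0 \<le> t"
    and z0: "snd (z 0) \<in> {0..1}"
  shows "snd (z t) \<in> {0..1}"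
proof -
  note s = filippov_solution_abs_cont_on[OF sol I t]
  have le: "norm (snd (z q) - snd (z p)) \<le> norm (z q - z p)" for p q
    using norm_snd_le[of "snd (z q - z p)" "fst (z q - z p)"] unfolding prod.collapse by simp
  have "snd (z t) - 1 \<le> 0"
  proof (rule abs_cont_barrier[OF _ t(2)])
    show "abs_cont_on (\<lambda>t. snd (z t) - 1) 0 t"
      by (rule abs_cont_on_dominated[OF s(2), of 1 0]) (use le in auto)
    show "AE s in lebesgue. s \<in> {0..t} \<longrightarrow> 0 < snd (z s) - 1 \<longrightarrow>
        (\<exists>v\<le>0. ((\<lambda>t. snd (z t) - 1) has_vector_derivative v) (at s within {0..t}))"
      using filippov_solution_AE[OF sol s(1)]
    proof (eventually_elim, intro impI, goal_cases)
      case (1 s)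
      then obtain v where v: "(z has_vector_derivative v) (at s within {0..t})" "v \<in> filippov_map (field G H) (z s)"
        by blast
      have "((\<lambda>t. snd (z t) - 1) has_vector_derivative snd v - 0) (at s within {0..t})"
        by (intro has_vector_derivative_diff has_vector_derivative_const
            bounded_linear.has_vector_derivative[OF bounded_linear_snd v(1)])
      then show ?case using filippov_map_above[OF _ v(2)] 1 by auto
    qed
  qed (use z0 in auto)
  moreover have "- snd (z t) \<le> 0"
  proof (rule abs_cont_barrier[OF _ t(2)])
    show "abs_cont_on (\<lambda>t. - snd (z t)) 0 t"
      by (rule abs_cont_on_dominated[OF s(2), of 1 0]) (simp_all, metis le abs_minus_commute real_norm_def)
    show "AE s in lebesgue. s \<in> {0..t} \<longrightarrow> 0 < - snd (z s) \<longrightarrow>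
        (\<exists>v\<le>0. ((\<lambda>t. - snd (z t)) has_vector_derivative v) (at s within {0..t}))"
      using filippov_solution_AE[OF sol s(1)]
    proof (eventually_elim, intro impI, goal_cases)
      case (1 s)
      then obtain v where v: "(z has_vector_derivative v) (at s within {0..t})" "v \<in> filippov_map (field G H) (z s)"
        by blast
      have "((\<lambda>t. - snd (z t)) has_vector_derivative - snd v) (at s within {0..t})"
        by (intro has_vector_derivative_minus
            bounded_linear.has_vector_derivative[OF bounded_linear_snd v(1)])
      then show ?case using filippov_map_below[OF _ v(2)] 1 by (intro exI[of _ "- snd v"]) auto
    qed
  qed (use z0 in auto)
  ultimately show ?thesis by simp
qed

section \<open>The derivative of a Lipschitz function on its zero set\<close>

lemma countable_components_open:
  fixes O' :: "'a::euclidean_space set"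
  assumes "open O'"
  shows "countable (components O')"
proof (rule countable_disjoint_open_subsets)
  show "open S" if "S \<in> components O'" for S using open_components assms that by blast
  show "disjoint (components O')"
    by (auto simp: pairwise_def disjnt_def components_nonoverlap)
qed

text \<open>
  Borel--Cantelli. As the centre of the dilated interval any point of \<open>K\<close> will do; \<open>SOME\<close> is junk only for
  \<open>K = {}\<close>, where the ball degenerates to a point.
\<close>

lemma AE_finite_dilates:
  fixes \<K> :: "real set set"
  assumes cnt: "countable \<K>" and dis: "disjoint \<K>" and op: "\<And>K. K \<in> \<K> \<Longrightarrow> open K"
    and sub: "\<Union>\<K> \<subseteq> {a..b}" and C: "C > 0"
  shows "AE t in lebesgue. finite {K \<in> \<K>. t \<in> cball (SOME x. x \<in> K) (C * measure lebesgue K)}"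
proof (cases "finite \<K>")
  case False
  define e where "e = from_nat_into \<K>"
  have e: "bij_betw e UNIV \<K>" unfolding e_def by (rule bij_betw_from_nat_into[OF cnt False])
  have eK: "e n \<in> \<K>" for n using e by (auto simp: bij_betw_def)
  have meas: "e n \<in> sets lebesgue" for n using op[OF eK[of n]] by auto
  have djf: "disjoint_family e"
    unfolding disjoint_family_on_def
  proof (intro ballI impI)
    fix m n :: nat assume "m \<noteq> n"
    then have "e m \<noteq> e n" using e by (auto simp: bij_betw_def inj_on_def)
    then show "e m \<inter> e n = {}" using pairwiseD[OF dis eK eK] by (simp add: disjnt_def)
  qed
  \<comment> \<open>Disjoint sets within \<open>{a..b}\<close> have summable lengths, and dilation
    only multiplies these by the constant \<open>2 * C\<close>.\<close>
  have "(\<lambda>n. measure lebesgue (e n)) sums measure lebesgue (\<Union>n. e n)"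
  proof (rule measure_UNION)
    have "emeasure lebesgue (\<Union>n. e n) \<le> emeasure lebesgue {a..b}"
      using sub eK by (intro emeasure_mono) auto
    also have "\<dots> < \<infinity>" by (simp add: emeasure_lborel_Icc_eq)
    finally show "emeasure lebesgue (\<Union>n. e n) \<noteq> \<infinity>" by simp
  qed (use meas djf in auto)
  then have summ: "summable (\<lambda>n. measure lebesgue (e n))" by (rule sums_summable)
  let ?B = "\<lambda>K. cball (SOME x. x \<in> K) (C * measure lebesgue K)"
  have "measure lebesgue (?B K) = 2 * (C * measure lebesgue K)" for K :: "real set"
  proof -
    have "?B K = {(SOME x. x \<in> K) - C * measure lebesgue K..(SOME x. x \<in> K) + C * measure lebesgue K}"
      by (rule cball_eq_atLeastAtMost)
    then show ?thesis using C by (simp add: mult_nonneg_nonneg)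
  qed
  then have "summable (\<lambda>n. measure lebesgue (?B (e n)))" by (simp add: summ summable_mult)
  then have "AE t in lebesgue. \<forall>\<^sub>F n in sequentially. t \<in> space lebesgue - ?B (e n)"
    by (intro borel_cantelli_AE1) (auto simp: emeasure_bounded_finite[OF bounded_cball, simplified])
  then show ?thesis
  proof eventually_elim
    fix t assume "\<forall>\<^sub>F n in sequentially. t \<in> space lebesgue - ?B (e n)"
    then obtain N where N: "\<And>n. n \<ge> N \<Longrightarrow> t \<notin> ?B (e n)" unfolding eventually_sequentially by blast
    have "{K \<in> \<K>. t \<in> ?B K} \<subseteq> e ` {..<N}"
    proof
      fix K assume K: "K \<in> {K \<in> \<K>. t \<in> ?B K}"
      then have "K \<in> range e" using e by (auto simp: bij_betw_def)
      then obtain n where n: "K = e n" by blast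
      then have "n < N" using N[of n] K not_le by blast
      then show "K \<in> e ` {..<N}" using n by blast
    qed
    then show "finite {K \<in> \<K>. t \<in> ?B K}" by (rule finite_subset) simp
  qed
qed auto

lemma diff_le_measure_of_interval_subset:
  fixes K :: "real set"
  assumes "K \<in> lmeasurable" "{p<..<q} \<subseteq> K"
  shows "q - p \<le> measure lebesgue K"
proof (cases "p \<le> q")
  case True
  have "measure lebesgue {p<..<q} \<le> measure lebesgue K"
    using assms by (intro measure_mono_fmeasurable) auto
  then show ?thesis using True by simp
next
  case False
  then show ?thesis using measure_nonneg[of lebesgue K] by linarith
qed


text \<open>Going from \<open>s\<close> towards \<open>t\<close>, the first zero met is an end of
  the gap \<open>K\<close>: the stretch up to it lies in \<open>K\<close>, so it is no longer than
  \<open>measure lebesgue K\<close>, and \<open>u\<close> falls to zero along it. The zero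
  \<open>t\<close> inside \<open>{a<..<b}\<close> ensures that the gap does not run up to
  \<open>a\<close> or \<open>b\<close> on this side.\<close>

lemma lipschitz_le_component_measure:
  fixes u :: "real \<Rightarrow> real"
  assumes lip: "M-lipschitz_on UNIV u"
    and K: "K \<in> components ({a<..<b} \<inter> {t. u t \<noteq> 0})" "K \<in> lmeasurable" "s \<in> K"
    and t: "t \<in> {a<..<b}" "u t = 0"
  shows "\<bar>u s\<bar> \<le> M * measure lebesgue K"
proof -
  let ?O = "{a<..<b} \<inter> {t. u t \<noteq> 0}"
  have M: "M \<ge> 0" using lip by (simp add: lipschitz_on_def)
  have "s \<in> ?O" using K(1,3) in_components_subset by blast
  then have s: "a < s" "s < b" "u s \<noteq> 0" by auto
  \<comment> \<open>Shared by both directions: \<open>J\<close> is the part of the gap from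
    \<open>s\<close> up to the zero \<open>z\<close>.\<close>
  have seg: "\<bar>u s\<bar> \<le> M * measure lebesgue K"
    if z: "u z = 0" and J: "connected J" "s \<in> J" "J \<subseteq> ?O" "{min s z<..<max s z} \<subseteq> J" for z J
  proof -
    have "J \<subseteq> K" using components_maximal[OF K(1) J(1,3)] J(2) K(3) by blast
    then have "max s z - min s z \<le> measure lebesgue K"
      using J(4) by (intro diff_le_measure_of_interval_subset[OF K(2)]) blast
    then have "\<bar>s - z\<bar> \<le> measure lebesgue K" by linarith
    moreover have us: "\<bar>u s\<bar> \<le> M * \<bar>s - z\<bar>"
      using lipschitz_onD[OF lip, of s z] z by (simp add: dist_real_def)
    ultimately show ?thesis using M by (meson mult_left_mono order_trans)
  qed
  have cont: "continuous_on UNIV u" using lip by (rule lipschitz_on_continuous_on)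
  have zclosed: "closed {r. u r = 0}" by (intro closed_Collect_eq cont continuous_on_const)
  show ?thesis
  proof (cases "t < s")
    case True
    define Z where "Z = {r. u r = 0} \<inter> {t..s}"
    have "closed Z" unfolding Z_def using zclosed by (intro closed_Int closed_atLeastAtMost)
    moreover have "t \<in> Z" using True t by (simp add: Z_def)
    moreover have bdd: "bdd_above Z" by (auto simp: Z_def intro: bdd_aboveI[of _ s])
    ultimately have zZ: "Sup Z \<in> Z" using closed_contains_Sup by blast
    then have z: "u (Sup Z) = 0" "t \<le> Sup Z" "Sup Z \<le> s" by (auto simp: Z_def)
    then have "Sup Z < s" using s(3) by (metis order_le_imp_less_or_eq)
    have "r \<in> ?O" if "Sup Z < r" "r \<le> s" for r
    proof -
      have "r \<notin> Z" using cSup_upper[OF _ bdd] that by fastforce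
      then have "u r \<noteq> 0" using that z by (simp add: Z_def)
      then show ?thesis using that z s t by simp
    qed
    then have "{Sup Z<..s} \<subseteq> ?O" by (meson greaterThanAtMost_iff subsetI)
    moreover have "{min s (Sup Z)<..<max s (Sup Z)} \<subseteq> {Sup Z<..s}" using \<open>Sup Z < s\<close> by auto
    ultimately show ?thesis using z \<open>Sup Z < s\<close> by (intro seg[of "Sup Z" "{Sup Z<..s}"]) auto
  next
    case False
    then have "s < t" using s t by (metis linorder_neqE)
    define Z where "Z = {r. u r = 0} \<inter> {s..t}"
    have "closed Z" unfolding Z_def using zclosed by (intro closed_Int closed_atLeastAtMost)
    moreover have "t \<in> Z" using \<open>s < t\<close> t by (simp add: Z_def)
    moreover have bdd: "bdd_below Z" by (auto simp: Z_def intro: bdd_belowI[of _ s])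
    ultimately have zZ: "Inf Z \<in> Z" using closed_contains_Inf by blast
    then have z: "u (Inf Z) = 0" "s \<le> Inf Z" "Inf Z \<le> t" by (auto simp: Z_def)
    then have "s < Inf Z" using s(3) by (metis order_le_imp_less_or_eq)
    have "r \<in> ?O" if "s \<le> r" "r < Inf Z" for r
    proof -
      have "r \<notin> Z" using cInf_lower[OF _ bdd] that by fastforce
      then have "u r \<noteq> 0" using that z by (simp add: Z_def)
      then show ?thesis using that z s t by simp
    qed
    then have "{s..<Inf Z} \<subseteq> ?O" by (meson atLeastLessThan_iff subsetI)
    moreover have "{min s (Inf Z)<..<max s (Inf Z)} \<subseteq> {s..<Inf Z}" using \<open>s < Inf Z\<close> by auto
    ultimately show ?thesis using z \<open>s < Inf Z\<close> by (intro seg[of "Inf Z" "{s..<Inf Z}"]) auto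
  qed
qed

text \<open>
  If \<open>\<bar>u s\<bar> > e * \<bar>s - t\<bar>\<close> at a zero \<open>t\<close>, the gap of the zero set containing \<open>s\<close> has length at least
  \<open>\<bar>u s\<bar> / M\<close>, so a fixed dilate of that gap contains \<open>t\<close>. Almost every \<open>t\<close> lies in finitely many such
  dilates only, and those gaps stay away from \<open>t\<close>. This replaces Lebesgue's density theorem.
\<close>

lemma AE_lipschitz_zero_set_eps:
  fixes u :: "real \<Rightarrow> real"
  assumes lip: "M-lipschitz_on UNIV u" and M: "M > 0" and e: "e > 0"
  shows "AE t in lebesgue. t \<in> {a<..<b} \<longrightarrow> u t = 0 \<longrightarrow> (\<exists>d>0. \<forall>s. \<bar>s - t\<bar> < d \<longrightarrow> \<bar>u s\<bar> \<le> e * \<bar>s - t\<bar>)"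
proof -
  have cont: "continuous_on UNIV u" using lip by (rule lipschitz_on_continuous_on)
  define O' where "O' = {a<..<b} \<inter> {t. u t \<noteq> 0}"
  have O': "open O'" unfolding O'_def
    by (intro open_Int open_greaterThanLessThan open_Collect_neq cont continuous_on_const)
  define \<K> where "\<K> = components O'"
  have cnt: "countable \<K>" unfolding \<K>_def by (rule countable_components_open[OF O'])
  have opK: "open K" if "K \<in> \<K>" for K using open_components O' that unfolding \<K>_def by blast
  have sub: "\<Union>\<K> = O'" by (simp add: \<K>_def)
  have subK: "K \<subseteq> {a<..<b}" if "K \<in> \<K>" for K using sub that by (auto simp: O'_def)
  have conn: "connected K" if "K \<in> \<K>" for K using in_components_connected that by (auto simp: \<K>_def)
  have lm: "K \<in> lmeasurable" if "K \<in> \<K>" for K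
  proof (rule bounded_set_imp_lmeasurable)
    have "K \<subseteq> {a..b}" using subK[OF that] by force
    then show "bounded K" by (rule bounded_subset[OF bounded_closed_interval])
  qed (use opK[OF that] in auto)
  \<comment> \<open>The ends of countably many gaps form a null set. Away from it a zero of
    \<open>u\<close> lies in no closed gap, so it keeps a positive distance from any finitely many
    of them.\<close>
  have "negligible (frontier K)" if "K \<in> \<K>" for K
    using conn[OF that] by (intro negligible_convex_frontier) (simp add: is_interval_connected_1[symmetric] is_interval_convex_1[symmetric])
  then have "negligible (\<Union>(frontier ` \<K>))" using cnt by (intro negligible_countable_Union) auto
  then have fr: "AE t in lebesgue. t \<notin> \<Union>(frontier ` \<K>)"
    by (intro AE_not_in) (simp add: negligible_iff_null_sets)
  \<comment> \<open>A violation at \<open>s\<close> gives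
    \<open>abs (s - t) < M / e * measure lebesgue K\<close>; the \<open>1\<close> pays for moving
    from \<open>s\<close> to the arbitrary centre of the gap.\<close>
  define C where "C = M / e + 1"
  have C: "C > 0" using M e by (simp add: C_def add_pos_pos)
  have "AE t in lebesgue. finite {K \<in> \<K>. t \<in> cball (SOME x. x \<in> K) (C * measure lebesgue K)}"
  proof (rule AE_finite_dilates[OF cnt _ opK _ C])
    show "disjoint \<K>" by (auto simp: \<K>_def pairwise_def disjnt_def components_nonoverlap)
    show "\<Union>\<K> \<subseteq> {a..b}" by (auto simp: sub O'_def)
  qed
  then show ?thesis using fr
  proof eventually_elim
    fix t
    assume fin: "finite {K \<in> \<K>. t \<in> cball (SOME x. x \<in> K) (C * measure lebesgue K)}" (is "finite ?S")
      and nfr: "t \<notin> \<Union>(frontier ` \<K>)"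
    show "t \<in> {a<..<b} \<longrightarrow> u t = 0 \<longrightarrow> (\<exists>d>0. \<forall>s. \<bar>s - t\<bar> < d \<longrightarrow> \<bar>u s\<bar> \<le> e * \<bar>s - t\<bar>)"
    proof (intro impI)
      assume t: "t \<in> {a<..<b}" and ut: "u t = 0"
      have "t \<notin> \<Union>(closure ` ?S)"
      proof
        assume "t \<in> \<Union>(closure ` ?S)"
        then obtain K where K: "K \<in> \<K>" "t \<in> closure K" by blast
        have "t \<notin> K" using ut sub K by (auto simp: O'_def)
        then show False using nfr K opK by (auto simp: frontier_def interior_open)
      qed
      then have "t \<in> {a<..<b} - \<Union>(closure ` ?S)" using t by blast
      moreover have "open ({a<..<b} - \<Union>(closure ` ?S))" using fin by (intro open_Diff closed_Union) auto
      ultimately obtain d where d: "d > 0" "ball t d \<subseteq> {a<..<b} - \<Union>(closure ` ?S)"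
        by (meson open_contains_ball)
      have "\<bar>u s\<bar> \<le> e * \<bar>s - t\<bar>" if st: "\<bar>s - t\<bar> < d" for s
      proof (rule ccontr)
        assume bad: "\<not> \<bar>u s\<bar> \<le> e * \<bar>s - t\<bar>"
        have sb: "s \<in> ball t d" using st by (simp add: dist_real_def)
        have us: "u s \<noteq> 0" using bad e by (metis abs_0 abs_ge_zero less_imp_le mult_nonneg_nonneg)
        have sO: "s \<in> O'" using sb d us by (auto simp: O'_def)
        then obtain K where K: "K \<in> \<K>" "s \<in> K" using sub by blast
        have KS: "K \<notin> ?S" using sb d(2) K(2) closure_subset by blast
        have len: "\<bar>u s\<bar> \<le> M * measure lebesgue K"
          using lipschitz_le_component_measure[OF lip _ lm[OF K(1)] K(2) t ut] M K(1) by (simp add: \<K>_def O'_def)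
        define x where "x = (SOME x. x \<in> K)"
        have xK: "x \<in> K" unfolding x_def using K(2) by (rule someI)
        have "{min x s..max x s} \<subseteq> K"
          using connected_contains_Icc[OF conn[OF K(1)] xK K(2)] connected_contains_Icc[OF conn[OF K(1)] K(2) xK]
          by (cases "x \<le> s") auto
        then have "max x s - min x s \<le> measure lebesgue K"
          by (intro diff_le_measure_of_interval_subset lm K) auto
        then have xs: "\<bar>x - s\<bar> \<le> measure lebesgue K" by linarith
        have "e * \<bar>s - t\<bar> < M * measure lebesgue K" using bad len by linarith
        then have "\<bar>s - t\<bar> < M / e * measure lebesgue K" using e by (simp add: field_simps)
        then have "\<bar>x - t\<bar> \<le> C * measure lebesgue K" using xs by (simp add: C_def algebra_simps)
        then have "t \<in> cball x (C * measure lebesgue K)" by (simp add: dist_real_def)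
        then show False using KS K(1) by (simp add: x_def)
      qed
      then show "\<exists>d>0. \<forall>s. \<bar>s - t\<bar> < d \<longrightarrow> \<bar>u s\<bar> \<le> e * \<bar>s - t\<bar>" using d(1) by blast
    qed
  qed
qed

text \<open>The exceptional set depends on the tolerance; running through
  \<open>inverse (real (Suc n))\<close> collects them into a single null set.\<close>

lemma AE_lipschitz_zero_set_derivative:
  fixes u :: "real \<Rightarrow> real"
  assumes lip: "M-lipschitz_on UNIV u" and M: "M > 0"
  shows "AE t in lebesgue. t \<in> {a<..<b} \<longrightarrow> u t = 0 \<longrightarrow> (u has_vector_derivative 0) (at t)"
proof -
  have "AE t in lebesgue. \<forall>n. t \<in> {a<..<b} \<longrightarrow> u t = 0 \<longrightarrow>
     (\<exists>d>0. \<forall>s. \<bar>s - t\<bar> < d \<longrightarrow> \<bar>u s\<bar> \<le> inverse (real (Suc n)) * \<bar>s - t\<bar>)"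
    unfolding AE_all_countable by (intro allI AE_lipschitz_zero_set_eps[OF lip M]) simp
  then show ?thesis
  proof (eventually_elim, intro impI)
    fix t
    assume *: "\<forall>n. t \<in> {a<..<b} \<longrightarrow> u t = 0 \<longrightarrow>
     (\<exists>d>0. \<forall>s. \<bar>s - t\<bar> < d \<longrightarrow> \<bar>u s\<bar> \<le> inverse (real (Suc n)) * \<bar>s - t\<bar>)"
      and t: "t \<in> {a<..<b}" "u t = 0"
    show "(u has_vector_derivative 0) (at t)"
      unfolding has_vector_derivative_def has_derivative_within_alt
    proof (intro conjI allI impI)
      fix e :: real assume "e > 0"
      then obtain n where n: "inverse (real (Suc n)) < e" using reals_Archimedean by blast
      obtain d where d: "d > 0" "\<And>s. \<bar>s - t\<bar> < d \<Longrightarrow> \<bar>u s\<bar> \<le> inverse (real (Suc n)) * \<bar>s - t\<bar>"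
        using * t by blast
      have "\<bar>u s\<bar> \<le> e * \<bar>s - t\<bar>" if "\<bar>s - t\<bar> < d" for s
        using d(2)[OF that] n mult_right_mono[of "inverse (real (Suc n))" e "\<bar>s - t\<bar>"] by linarith
      then show "\<exists>d>0. \<forall>y\<in>UNIV. norm (y - t) < d \<longrightarrow> norm (u y - u t - (y - t) *\<^sub>R 0) \<le> e * norm (y - t)"
        using d(1) t by auto
    qed simp
  qed
qed

section \<open>Reflected differential equations\<close>

text \<open>The Skorokhod regulator at barrier zero: for continuous \<open>f\<close>, the least
  nonnegative nondecreasing \<open>m\<close> with \<open>f - m\<close> nonpositive on
  \<open>{0..}\<close>. For negative \<open>t\<close> the supremum is over the empty set, so all
  facts about it concern nonnegative times.\<close>

definition running_max :: "(real \<Rightarrow> real) \<Rightarrow> real \<Rightarrow> real" where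
  "running_max f t = (SUP s\<in>{0..t}. max 0 (f s))"

lemma running_max_upper:
  assumes f: "continuous_on UNIV f" and s: "0 \<le> s" "s \<le> t"
  shows "f s \<le> running_max f t" "0 \<le> running_max f t"
proof -
  have "continuous_on {0..t} (\<lambda>s. max 0 (f s))"
    by (intro continuous_intros continuous_on_subset[OF f]) auto
  then have "bdd_above ((\<lambda>s. max 0 (f s)) ` {0..t})"
    by (intro bounded_imp_bdd_above compact_imp_bounded compact_continuous_image) auto
  then have "max 0 (f s) \<le> running_max f t"
    unfolding running_max_def by (rule cSUP_upper[rotated]) (use s in auto)
  then show "f s \<le> running_max f t" "0 \<le> running_max f t" by auto
qed

lemma running_max_least:
  assumes "0 \<le> t" "0 \<le> B" "\<And>s. 0 \<le> s \<Longrightarrow> s \<le> t \<Longrightarrow> f s \<le> B"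
  shows "running_max f t \<le> B"
  unfolding running_max_def by (rule cSUP_least) (use assms in auto)

lemma running_max_mono:
  assumes "continuous_on UNIV f" "0 \<le> s" "s \<le> t"
  shows "running_max f s \<le> running_max f t"
  by (rule running_max_least) (use assms running_max_upper[OF assms(1)] in auto)

text \<open>Values of \<open>f\<close> before \<open>s\<close> are already counted in
  \<open>running_max f s\<close>, so only those on \<open>{s..t}\<close> can raise it. Continuity,
  the Lipschitz bound and, with \<open>e = 0\<close>, local constancy are all read off from
  this.\<close>

lemma running_max_le_add:
  assumes f: "continuous_on UNIV f" and s: "0 \<le> s" "s \<le> t" and e: "e \<ge> 0"
    and le: "\<And>r. s \<le> r \<Longrightarrow> r \<le> t \<Longrightarrow> f r \<le> running_max f s + e"
  shows "running_max f t \<le> running_max f s + e"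
proof (rule running_max_least)
  fix r assume r: "0 \<le> r" "r \<le> t"
  show "f r \<le> running_max f s + e"
  proof (cases "s \<le> r")
    case False
    then show ?thesis using running_max_upper(1)[OF f r(1), of s] e by linarith
  qed (use le r in auto)
qed (use s e running_max_upper(2)[OF f, of s s] in auto)

lemma continuous_on_running_max:
  assumes f: "continuous_on UNIV f"
  shows "continuous_on {0..} (running_max f)"
  unfolding continuous_on_iff
proof (intro ballI allI impI)
  fix t e :: real assume t: "t \<in> {0..}" and e: "e > 0"
  obtain d where d: "d > 0" "\<And>s. dist s t < d \<Longrightarrow> dist (f s) (f t) < e / 4"
    using f[unfolded continuous_on_iff, rule_format, of t "e / 4"] e by auto
  have *: "running_max f q \<le> running_max f p + e / 2"
    if pq: "0 \<le> p" "p \<le> q" "dist p t < d" "dist q t < d" for p q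
  proof (rule running_max_le_add[OF f pq(1,2)])
    fix r assume "p \<le> r" "r \<le> q"
    then have "dist r t < d" using pq by (auto simp: dist_real_def)
    then have "f r \<le> f p + e / 2" using d(2)[of r] d(2)[OF pq(3)] unfolding dist_real_def by arith
    then show "f r \<le> running_max f p + e / 2" using running_max_upper(1)[OF f pq(1), of p] by auto
  qed (use e in auto)
  show "\<exists>d>0. \<forall>s\<in>{0..}. dist s t < d \<longrightarrow> dist (running_max f s) (running_max f t) < e"
  proof (intro exI[of _ d] conjI d(1) ballI impI)
    fix s assume s: "s \<in> {0..}" "dist s t < d"
    show "dist (running_max f s) (running_max f t) < e"
    proof (cases "s \<le> t")
      case True
      then show ?thesis using *[of s t] running_max_mono[OF f, of s t] s t d(1) e by (auto simp: dist_real_def)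
    next
      case False
      then show ?thesis using *[of t s] running_max_mono[OF f, of t s] s t d(1) e by (auto simp: dist_real_def)
    qed
  qed
qed

text \<open>This nonexpansiveness in the sup norm is what makes the reflected Picard map a
  contraction. \<open>D\<close> bounds the difference on the whole line because paths are later
  compared as bounded continuous functions there.\<close>

lemma running_max_diff_le:
  assumes f: "continuous_on UNIV f" and g: "continuous_on UNIV g" and t: "0 \<le> t"
    and D: "\<And>s. \<bar>f s - g s\<bar> \<le> D"
  shows "\<bar>running_max f t - running_max g t\<bar> \<le> D"
proof -
  have "D \<ge> 0" using D[of 0] by linarith
  have "running_max f t \<le> running_max g t + D"
  proof (rule running_max_least[OF t])
    show "0 \<le> running_max g t + D" using running_max_upper(2)[OF g t order_refl] \<open>D \<ge> 0\<close> by simp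
    show "f s \<le> running_max g t + D" if "0 \<le> s" "s \<le> t" for s
      using running_max_upper(1)[OF g that] D[of s] by linarith
  qed
  moreover have "running_max g t \<le> running_max f t + D"
  proof (rule running_max_least[OF t])
    show "0 \<le> running_max f t + D" using running_max_upper(2)[OF f t order_refl] \<open>D \<ge> 0\<close> by simp
    show "g s \<le> running_max f t + D" if "0 \<le> s" "s \<le> t" for s
      using running_max_upper(1)[OF f that] D[of s] by linarith
  qed
  ultimately show ?thesis by linarith
qed

lemma running_max_lipschitz:
  assumes f: "M-lipschitz_on UNIV f"
  shows "M-lipschitz_on {0..} (running_max f)"
proof -
  have cont: "continuous_on UNIV f" using f by (rule lipschitz_on_continuous_on)
  have M: "M \<ge> 0" using f by (simp add: lipschitz_on_def)
  have *: "\<bar>running_max f t - running_max f s\<bar> \<le> M * (t - s)" if st: "0 \<le> s" "s \<le> t" for s t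
  proof -
    have "running_max f t \<le> running_max f s + M * (t - s)"
    proof (rule running_max_le_add[OF cont st])
      fix r assume r: "s \<le> r" "r \<le> t"
      have "f r \<le> f s + M * (r - s)" using lipschitz_onD[OF f, of r s] r by (simp add: dist_real_def)
      also have "\<dots> \<le> running_max f s + M * (t - s)"
        using running_max_upper(1)[OF cont st(1) order_refl] r M by (intro add_mono mult_left_mono) auto
      finally show "f r \<le> running_max f s + M * (t - s)" .
    qed (use M st in auto)
    then show ?thesis using running_max_mono[OF cont st] by linarith
  qed
  show ?thesis
  proof (rule lipschitz_onI)
    fix s t :: real assume "s \<in> {0..}" "t \<in> {0..}"
    then show "dist (running_max f s) (running_max f t) \<le> M * dist s t"
      using *[of s t] *[of t s] by (cases "s \<le> t") (auto simp: dist_real_def abs_minus_commute)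
  qed fact
qed

text \<open>A level strictly between \<open>f t\<close> and the running maximum separates the two
  near \<open>t\<close>, so no new maximum is set there. Strictly inside the domain the reflection
  term is therefore constant and the path obeys the plain equation.\<close>

lemma running_max_locally_constant:
  assumes f: "continuous_on UNIV f" and t: "0 \<le> t" and less: "f t < running_max f t"
  obtains d where "d > 0" "\<And>s. 0 \<le> s \<Longrightarrow> dist s t < d \<Longrightarrow> running_max f s = running_max f t"
proof -
  define \<mu> where "\<mu> = (f t + running_max f t) / 2"
  have \<mu>: "f t < \<mu>" "\<mu> < running_max f t" using less by (auto simp: \<mu>_def)
  obtain d1 where d1: "d1 > 0" "\<And>s. dist s t < d1 \<Longrightarrow> dist (f s) (f t) < \<mu> - f t"
    using f[unfolded continuous_on_iff, rule_format, of t "\<mu> - f t"] \<mu> by auto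
  obtain d2 where d2: "d2 > 0"
    "\<And>s. 0 \<le> s \<Longrightarrow> dist s t < d2 \<Longrightarrow> dist (running_max f s) (running_max f t) < running_max f t - \<mu>"
    using continuous_on_running_max[OF f, unfolded continuous_on_iff, rule_format, of t "running_max f t - \<mu>"] \<mu> t
    by auto
  have *: "running_max f q = running_max f p"
    if pq: "0 \<le> p" "p \<le> q" "dist p t < min d1 d2" "dist q t < min d1 d2" for p q
  proof -
    have "running_max f q \<le> running_max f p + 0"
    proof (rule running_max_le_add[OF f pq(1,2)])
      fix r assume "p \<le> r" "r \<le> q"
      then have "dist r t < d1" using pq by (auto simp: dist_real_def)
      then have "f r < \<mu>" using d1(2)[of r] by (auto simp: dist_real_def)
      moreover have "\<mu> < running_max f p" using d2(2)[of p] pq by (auto simp: dist_real_def)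
      ultimately show "f r \<le> running_max f p + 0" by simp
    qed simp
    then show ?thesis using running_max_mono[OF f pq(1,2)] by simp
  qed
  show ?thesis
  proof (rule that[of "min d1 d2"])
    fix s assume "0 \<le> s" "dist s t < min d1 d2"
    then show "running_max f s = running_max f t"
      using *[of s t] *[of t s] t d1(1) d2(1) by (cases "s \<le> t") auto
  qed (use d1 d2 in auto)
qed

text \<open>
  The Skorokhod problem for reflection at \<open>y = c\<close>: in terms of the unreflected path \<open>w\<close> the reflected one is
  \<open>w - (0, running_max (w\<^sub>2 - c))\<close>, a Lipschitz map in the sup norm, so Picard iteration contracts.
\<close>

lemma reflected_ode_fixpoint:
  fixes k :: "real \<times> real \<Rightarrow> real \<times> real"
  assumes lip: "L-lipschitz_on UNIV k" and M: "\<And>p. norm (k p) \<le> M" and T: "T > 0" and LT: "4 * L * T \<le> 1"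
  obtains w where "w 0 = z0" "M-lipschitz_on UNIV w"
    "\<And>t. t \<in> {0..T} \<Longrightarrow> (w has_vector_derivative k (w t - (0, running_max (\<lambda>s. snd (w s) - c) t))) (at t within {0..T})"
proof -
  have L: "L \<ge> 0" using lip by (simp add: lipschitz_on_def)
  have M0: "M \<ge> 0" using M[of 0] norm_ge_zero order_trans by blast
  have kc: "continuous_on UNIV k" using lip by (rule lipschitz_on_continuous_on)
  define \<rho> where "\<rho> w t = w t - (0, running_max (\<lambda>s. snd (w s) - c) t)" for w :: "real \<Rightarrow> real \<times> real" and t
  \<comment> \<open>Clamping time to \<open>{0..T}\<close> makes \<open>\<Phi> w\<close>, for
    continuous \<open>w\<close>, a bounded Lipschitz function on the whole line, so that Banach's
    theorem applies in the complete space of bounded continuous functions.\<close>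
  define \<tau> where "\<tau> t = max 0 (min T t)" for t :: real
  define \<Phi> where "\<Phi> w t = z0 + integral {0..\<tau> t} (\<lambda>s. k (\<rho> w s))" for w t
  have \<tau>: "0 \<le> \<tau> t" "\<tau> t \<le> T" for t using T by (auto simp: \<tau>_def)
  have sc: "continuous_on UNIV (\<lambda>s. snd (w s) - c)" if "continuous_on UNIV w" for w :: "real \<Rightarrow> real \<times> real"
    using that by (intro continuous_intros)
  have kr: "continuous_on {0..T} (\<lambda>s. k (\<rho> w s))" if w: "continuous_on UNIV w" for w
  proof (rule continuous_on_compose2[OF kc])
    show "continuous_on {0..T} (\<rho> w)" unfolding \<rho>_def
      by (intro continuous_intros continuous_on_subset[OF w] continuous_on_subset[OF continuous_on_running_max[OF sc[OF w]]]) auto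
  qed simp
  have int: "(\<lambda>s. k (\<rho> w s)) integrable_on {a..b}" if w: "continuous_on UNIV w" and ab: "0 \<le> a" "b \<le> T" for w a b
    by (rule integrable_continuous_real, rule continuous_on_subset[OF kr[OF w]]) (use ab in auto)
  have \<Phi>diff: "norm (\<Phi> w t - \<Phi> w s) \<le> M * \<bar>t - s\<bar>" if w: "continuous_on UNIV w" for w s t
  proof -
    have *: "norm (\<Phi> w t - \<Phi> w s) \<le> M * \<bar>t - s\<bar>" if "s \<le> t" for s t
    proof -
      have le: "\<tau> s \<le> \<tau> t" "\<tau> t - \<tau> s \<le> t - s" using that by (auto simp: \<tau>_def)
      have "integral {0..\<tau> s} (\<lambda>s. k (\<rho> w s)) + integral {\<tau> s..\<tau> t} (\<lambda>s. k (\<rho> w s)) = integral {0..\<tau> t} (\<lambda>s. k (\<rho> w s))"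
        by (rule Henstock_Kurzweil_Integration.integral_combine) (use \<tau> le int[OF w] in auto)
      then have "\<Phi> w t - \<Phi> w s = integral {\<tau> s..\<tau> t} (\<lambda>s. k (\<rho> w s))" by (simp add: \<Phi>_def algebra_simps)
      also have "norm \<dots> \<le> M * (\<tau> t - \<tau> s)"
      proof (rule integral_bound)
        show "continuous_on {\<tau> s..\<tau> t} (\<lambda>s. k (\<rho> w s))"
          by (rule continuous_on_subset[OF kr[OF w]]) (use \<tau>[of s] \<tau>[of t] in auto)
      qed (use le M in auto)
      also have "\<dots> \<le> M * (t - s)" using le M0 by (intro mult_left_mono) auto
      finally show ?thesis using that by simp
    qed
    show ?thesis using *[of s t] *[of t s] by (cases "s \<le> t") (auto simp: norm_minus_commute abs_minus_commute)
  qed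
  have \<Phi>lip: "M-lipschitz_on UNIV (\<Phi> w)" if "continuous_on UNIV w" for w
    using \<Phi>diff[OF that] M0 by (auto intro!: lipschitz_onI simp: dist_norm)
  have \<Phi>0: "\<Phi> w 0 = z0" for w using T by (simp add: \<Phi>_def \<tau>_def)
  have "\<Phi> w t = \<Phi> w (\<tau> t)" for w t using T by (auto simp: \<Phi>_def \<tau>_def)
  then have "norm (\<Phi> w t) \<le> norm z0 + M * T" if w: "continuous_on UNIV w" for w t
  proof -
    have "norm (\<Phi> w t - z0) \<le> M * \<tau> t" using \<Phi>diff[OF w, of "\<tau> t" 0] \<open>\<And>w t. \<Phi> w t = \<Phi> w (\<tau> t)\<close>[of w t] \<tau>[of t] \<Phi>0[of w] by simp
    also have "\<dots> \<le> M * T" using \<tau>[of t] M0 by (intro mult_left_mono)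
    finally show ?thesis using norm_triangle_sub[of "\<Phi> w t" z0] by linarith
  qed
  then have bc: "\<Phi> w \<in> bcontfun" if "continuous_on UNIV w" for w
    using that lipschitz_on_continuous_on[OF \<Phi>lip[OF that]] unfolding bcontfun_def bounded_iff by blast
  \<comment> \<open>The path and its running maximum each contribute one \<open>dist w v\<close>,
    \<open>k\<close> multiplies by \<open>L\<close> and integration by \<open>T\<close>; the factor
    \<open>2 * L * T\<close> is at most \<open>1/2\<close> by \<open>LT\<close>.\<close>
  have contr: "dist (Bcontfun (\<Phi> (apply_bcontfun w))) (Bcontfun (\<Phi> (apply_bcontfun v))) \<le> 1/2 * dist w v"
    for w v :: "real \<Rightarrow>\<^sub>C (real \<times> real)"
  proof (rule dist_bound)
    fix t
    have cw: "continuous_on UNIV (apply_bcontfun w)" and cv: "continuous_on UNIV (apply_bcontfun v)"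
      by (auto intro: continuous_on_apply_bcontfun)
    have pt: "norm (k (\<rho> w s) - k (\<rho> v s)) \<le> 2 * L * dist w v" if s: "s \<in> {0..T}" for s
    proof -
      have wv: "norm (w r - v r) \<le> dist w v" for r using dist_bounded[of w r v] by (simp add: dist_norm)
      have "\<bar>(snd (w r) - c) - (snd (v r) - c)\<bar> \<le> dist w v" for r
        using order_trans[OF dist_snd_le dist_bounded, of w r v] by (simp add: dist_real_def)
      then have rm: "\<bar>running_max (\<lambda>s. snd (w s) - c) s - running_max (\<lambda>s. snd (v s) - c) s\<bar> \<le> dist w v"
        using s by (intro running_max_diff_le sc cw cv) auto
      have "\<rho> w s - \<rho> v s = (w s - v s) - (0, running_max (\<lambda>s. snd (w s) - c) s - running_max (\<lambda>s. snd (v s) - c) s)"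
        by (simp add: \<rho>_def algebra_simps)
      also have "norm \<dots> \<le> norm (w s - v s) +
          norm ((0::real), running_max (\<lambda>s. snd (w s) - c) s - running_max (\<lambda>s. snd (v s) - c) s)"
        by (rule norm_triangle_ineq4)
      also have "\<dots> \<le> 2 * dist w v" using wv[of s] rm by simp
      finally have "norm (\<rho> w s - \<rho> v s) \<le> 2 * dist w v" .
      then have "L * norm (\<rho> w s - \<rho> v s) \<le> L * (2 * dist w v)" using L by (rule mult_left_mono)
      then show ?thesis using lipschitz_onD[OF lip, of "\<rho> w s" "\<rho> v s"] by (simp add: dist_norm)
    qed
    have "\<Phi> w t - \<Phi> v t = integral {0..\<tau> t} (\<lambda>s. k (\<rho> w s) - k (\<rho> v s))"
      unfolding \<Phi>_def using int[OF cw, of 0 "\<tau> t"] int[OF cv, of 0 "\<tau> t"] \<tau> by (simp add: integral_diff)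
    also have "norm \<dots> \<le> 2 * L * dist w v * (\<tau> t - 0)"
    proof (rule integral_bound)
      show "continuous_on {0..\<tau> t} (\<lambda>s. k (\<rho> w s) - k (\<rho> v s))"
        using \<tau>[of t] by (intro continuous_on_diff continuous_on_subset[OF kr[OF cw]] continuous_on_subset[OF kr[OF cv]]) auto
    qed (use \<tau>[of t] pt in auto)
    also have "\<dots> \<le> 2 * L * dist w v * T" using \<tau>[of t] L by (intro mult_left_mono) auto
    also have "\<dots> \<le> 1/2 * dist w v"
      using mult_right_mono[OF LT, of "dist w v / 2"] by (simp add: algebra_simps)
    finally show "dist (apply_bcontfun (Bcontfun (\<Phi> w)) t) (apply_bcontfun (Bcontfun (\<Phi> v)) t) \<le> 1/2 * dist w v"
      using Bcontfun_inverse[OF bc[OF cw]] Bcontfun_inverse[OF bc[OF cv]] by (simp add: dist_norm)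
  qed
  have "\<exists>!W. Bcontfun (\<Phi> (apply_bcontfun W)) = W"
    by (rule banach_fix_type[of "1/2"]) (use contr in simp_all)
  then obtain W where W: "Bcontfun (\<Phi> (apply_bcontfun W)) = W" by metis
  define w where "w = apply_bcontfun W"
  have cw: "continuous_on UNIV w" unfolding w_def by (rule continuous_on_apply_bcontfun)
  have fix_w: "\<Phi> w = w" using W Bcontfun_inverse[OF bc[OF cw]] unfolding w_def by metis
  show ?thesis
  proof (rule that[of w])
    show "w 0 = z0" using \<Phi>0[of w] fix_w by simp
    show "M-lipschitz_on UNIV w" using \<Phi>lip[OF cw] fix_w by simp
    fix t assume t: "t \<in> {0..T}"
    have "((\<lambda>u. z0 + integral {0..u} (\<lambda>s. k (\<rho> w s))) has_vector_derivative 0 + k (\<rho> w t)) (at t within {0..T})"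
      by (intro has_vector_derivative_add has_vector_derivative_const integral_has_vector_derivative kr cw t)
    moreover have "z0 + integral {0..u} (\<lambda>s. k (\<rho> w s)) = w u" if "u \<in> {0..T}" for u
    proof -
      have "\<tau> u = u" using that by (auto simp: \<tau>_def)
      then show ?thesis using fun_cong[OF fix_w, of u] by (simp add: \<Phi>_def)
    qed
    ultimately have "(w has_vector_derivative k (\<rho> w t)) (at t within {0..T})"
      using has_vector_derivative_transform[OF t, of w "\<lambda>u. z0 + integral {0..u} (\<lambda>s. k (\<rho> w s))"] by simp
    then show "(w has_vector_derivative k (w t - (0, running_max (\<lambda>s. snd (w s) - c) t))) (at t within {0..T})"
      by (simp add: \<rho>_def)
  qed
qed

text \<open>
  On the set of times with \<open>snd (z t) = c\<close> the derivative of \<open>snd \<circ> z\<close> vanishes almost everywhere. Since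
  \<open>snd \<circ> z\<close> is \<open>snd \<circ> w\<close> minus the nondecreasing running maximum, the drift \<open>snd \<circ> k\<close> must then point out
  of the domain, which is exactly the sliding condition.
\<close>

lemma reflected_ode_solution:
  fixes k :: "real \<times> real \<Rightarrow> real \<times> real"
  assumes lip: "L-lipschitz_on UNIV k" and M: "\<And>p. norm (k p) \<le> M" and T: "T > 0" and LT: "4 * L * T \<le> 1"
    and z0: "snd z0 \<le> c"
  obtains z where "z 0 = z0" "(2 * M)-lipschitz_on {0..T} z" "\<And>t. t \<in> {0..T} \<Longrightarrow> snd (z t) \<le> c"
    "\<And>t. t \<in> {0..T} \<Longrightarrow> snd (z t) < c \<Longrightarrow> (z has_vector_derivative k (z t)) (at t within {0..T})"
    "AE t in lebesgue. t \<in> {0..T} \<longrightarrow> snd (z t) = c \<longrightarrow>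
      snd (k (z t)) \<ge> 0 \<and> (z has_vector_derivative (fst (k (z t)), 0)) (at t within {0..T})"
proof -
  have M0: "M \<ge> 0" using M[of 0] norm_ge_zero order_trans by blast
  obtain w where w0: "w 0 = z0" and wlip: "M-lipschitz_on UNIV w"
    and wder: "\<And>t. t \<in> {0..T} \<Longrightarrow>
      (w has_vector_derivative k (w t - (0, running_max (\<lambda>s. snd (w s) - c) t))) (at t within {0..T})"
    using reflected_ode_fixpoint[OF lip M T LT] by metis
  define f where "f s = snd (w s) - c" for s
  define m where "m = running_max f"
  define z where "z t = w t - (0, m t)" for t
  have flip: "M-lipschitz_on UNIV f"
  proof (rule lipschitz_onI[OF _ M0])
    fix s t :: real
    have "dist (f s) (f t) = dist (snd (w s)) (snd (w t))" by (simp add: f_def dist_real_def)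
    also have "\<dots> \<le> dist (w s) (w t)" by (rule dist_snd_le)
    also have "\<dots> \<le> M * dist s t" using lipschitz_onD[OF wlip] by simp
    finally show "dist (f s) (f t) \<le> M * dist s t" .
  qed
  have fc: "continuous_on UNIV f" using flip by (rule lipschitz_on_continuous_on)
  have mlip: "M-lipschitz_on {0..} m" unfolding m_def by (rule running_max_lipschitz[OF flip])
  have zder: "(w has_vector_derivative k (z t)) (at t within {0..T})" if "t \<in> {0..T}" for t
    using wder[OF that] by (simp add: z_def m_def f_def[abs_def])
  have sndz: "snd (z t) - c = f t - m t" for t by (simp add: z_def f_def)
  have mupper: "f t \<le> m t" if "0 \<le> t" for t
    unfolding m_def using running_max_upper(1)[OF fc that order_refl] .
  have pairm: "((\<lambda>t. (0::real, m t)) has_vector_derivative (0, d)) (at x within S)"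
    if "(m has_vector_derivative d) (at x within S)" for d x S
    using has_vector_derivative_Pair[OF has_vector_derivative_const that] .
  show ?thesis
  proof (rule that[of z])
    have "m 0 = 0" unfolding m_def running_max_def using z0 by (simp add: f_def w0)
    then show "z 0 = z0" by (simp add: z_def w0 prod_eq_iff)
    show zlip: "(2 * M)-lipschitz_on {0..T} z"
    proof (rule lipschitz_onI)
      fix s t assume st: "s \<in> {0..T}" "t \<in> {0..T}"
      have "z s - z t = (w s - w t) - (0, m s - m t)" by (simp add: z_def algebra_simps)
      also have "norm \<dots> \<le> norm (w s - w t) + norm ((0::real), m s - m t)" by (rule norm_triangle_ineq4)
      also have "\<dots> \<le> M * dist s t + M * dist s t"
        using lipschitz_onD[OF wlip, of s t] lipschitz_onD[OF mlip, of s t] st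
        by (intro add_mono) (auto simp: dist_norm)
      finally show "dist (z s) (z t) \<le> 2 * M * dist s t" by (simp add: dist_norm)
    qed (use M0 in simp)
    show "snd (z t) \<le> c" if "t \<in> {0..T}" for t
      using sndz[of t] mupper[of t] that by auto
    show "(z has_vector_derivative k (z t)) (at t within {0..T})" if t: "t \<in> {0..T}" and less: "snd (z t) < c" for t
    proof -
      have "f t < running_max f t" using sndz[of t] less by (simp add: m_def)
      then obtain d where d: "d > 0" "\<And>s. 0 \<le> s \<Longrightarrow> dist s t < d \<Longrightarrow> m s = m t"
        using running_max_locally_constant[OF fc, of t] t unfolding m_def by (metis atLeastAtMost_iff)
      have "(m has_vector_derivative 0) (at t within {0..T})"
        by (rule has_vector_derivative_transform_within[OF has_vector_derivative_const d(1) t]) (use d(2) in auto)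
      from has_vector_derivative_diff[OF zder[OF t] pairm[OF this]]
      show ?thesis unfolding z_def by (simp add: z_def zero_prod_def[symmetric])
    qed
    \<comment> \<open>The lemma on zero sets asks for a function on the whole line with positive
      Lipschitz constant: clamping time gives the first, and an extra \<open>1\<close> in the
      constant the second even if \<open>M = 0\<close>.\<close>
    define u where "u t = snd (z (max 0 (min T t))) - c" for t
    have ulip: "(2 * M + 1)-lipschitz_on UNIV u"
    proof (rule lipschitz_onI)
      fix s t :: real
      let ?s = "max 0 (min T s)" and ?t = "max 0 (min T t)"
      have "dist (u s) (u t) = dist (snd (z ?s)) (snd (z ?t))" by (simp add: u_def dist_real_def)
      also have "\<dots> \<le> dist (z ?s) (z ?t)" by (rule dist_snd_le)
      also have "\<dots> \<le> 2 * M * dist ?s ?t" using lipschitz_onD[OF zlip, of ?s ?t] T by auto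
      also have "\<dots> \<le> (2 * M + 1) * dist s t"
        using M0 by (intro mult_mono) (auto simp: dist_real_def)
      finally show "dist (u s) (u t) \<le> (2 * M + 1) * dist s t" .
    qed (use M0 in simp)
    have "AE t in lebesgue. t \<in> {0<..<T} \<longrightarrow> u t = 0 \<longrightarrow> (u has_vector_derivative 0) (at t)"
      using AE_lipschitz_zero_set_derivative[OF ulip] M0 by simp
    moreover have "AE t in lebesgue. t \<notin> {0, T}"
      by (rule AE_not_in) (simp add: negligible_iff_null_sets[symmetric])
    ultimately show "AE t in lebesgue. t \<in> {0..T} \<longrightarrow> snd (z t) = c \<longrightarrow>
      snd (k (z t)) \<ge> 0 \<and> (z has_vector_derivative (fst (k (z t)), 0)) (at t within {0..T})"
    proof (eventually_elim, intro impI)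
      fix t assume der: "t \<in> {0<..<T} \<longrightarrow> u t = 0 \<longrightarrow> (u has_vector_derivative 0) (at t)"
        and "t \<notin> {0, T}" and t: "t \<in> {0..T}" and zc: "snd (z t) = c"
      then have ti: "t \<in> {0<..<T}" by auto
      have uz: "u s = f s - m s" if "s \<in> {0<..<T}" for s using that sndz[of s] by (simp add: u_def)
      have "u t = 0" using ti zc by (simp add: u_def)
      then have "(u has_vector_derivative 0) (at t)" using der ti by blast
      then have fm: "((\<lambda>s. f s - m s) has_vector_derivative 0) (at t)"
        by (rule has_vector_derivative_transform_within_open[OF _ _ ti]) (auto simp: uz)
      have "(w has_vector_derivative k (z t)) (at t)" using zder[OF t] ti by (simp add: at_within_Icc_at)
      then have "(f has_vector_derivative snd (k (z t)) - 0) (at t)"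
        unfolding f_def by (intro has_vector_derivative_diff has_vector_derivative_const
            bounded_linear.has_vector_derivative[OF bounded_linear_snd])
      \<comment> \<open>Differentiability of the running maximum at \<open>t\<close> is a
        consequence: it is the difference of \<open>f\<close> and \<open>f - m\<close>, both
        differentiable there.\<close>
      from has_vector_derivative_diff[OF this fm]
      have mder: "(m has_vector_derivative snd (k (z t))) (at t)" by simp
      have "mono_on {0..T} m" unfolding m_def
        by (intro mono_onI running_max_mono[OF fc]) auto
      moreover have "(m has_real_derivative snd (k (z t))) (at t)"
        using mder by (simp add: has_real_derivative_iff_has_vector_derivative)
      ultimately have "snd (k (z t)) \<ge> 0"
        using mono_on_imp_deriv_nonneg[of "{0..T}" m] ti by (simp add: interior_atLeastAtMost_real)
      moreover have "(z has_vector_derivative k (z t) - (0, snd (k (z t)))) (at t within {0..T})"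
        unfolding z_def using has_vector_derivative_diff[OF zder[OF t] pairm[OF has_vector_derivative_at_within[OF mder]]]
        by (simp add: z_def)
      moreover have "k (z t) - (0, snd (k (z t))) = (fst (k (z t)), 0)" by (simp add: prod_eq_iff)
      ultimately show "snd (k (z t)) \<ge> 0 \<and> (z has_vector_derivative (fst (k (z t)), 0)) (at t within {0..T})"
        by simp
    qed
  qed
qed

text \<open>The coefficients are controlled only on a ball. Composing them with its nearest-point
  map, which is nonexpansive, makes them bounded and globally Lipschitz; the time is cut so short
  that the solution stays in the ball, where this map is the identity.\<close>

lemma local_reflected_ode_solution:
  fixes g h :: "real \<times> real \<Rightarrow> real"
  assumes g: "L-lipschitz_on (cball z0 r) g" and h: "L-lipschitz_on (cball z0 r) h" and r: "r > 0"
    and z0: "snd z0 \<le> c"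
  obtains T C z where "T > 0" "z 0 = z0" "C-lipschitz_on {0..T} z"
    "\<And>t. t \<in> {0..T} \<Longrightarrow> z t \<in> cball z0 r" "\<And>t. t \<in> {0..T} \<Longrightarrow> snd (z t) \<le> c"
    "\<And>t. t \<in> {0..T} \<Longrightarrow> snd (z t) < c \<Longrightarrow> (z has_vector_derivative (g (z t), h (z t))) (at t within {0..T})"
    "AE t in lebesgue. t \<in> {0..T} \<longrightarrow> snd (z t) = c \<longrightarrow>
      h (z t) \<ge> 0 \<and> (z has_vector_derivative (g (z t), 0)) (at t within {0..T})"
proof -
  define P where "P = closest_point (cball z0 r)"
  have P: "P p \<in> cball z0 r" for p unfolding P_def using r by (intro closest_point_in_set) auto
  have Pid: "P p = p" if "p \<in> cball z0 r" for p unfolding P_def using that by (rule closest_point_self)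
  have P1: "dist (P p) (P q) \<le> dist p q" for p q
    unfolding P_def using r by (intro closest_point_lipschitz) auto
  define k where "k p = (g (P p), h (P p))" for p
  have L: "L \<ge> 0" using g by (simp add: lipschitz_on_def)
  have klip: "(2 * L)-lipschitz_on UNIV k"
  proof (rule lipschitz_onI)
    fix p q
    have "k p - k q = (g (P p) - g (P q), 0) + (0, h (P p) - h (P q))" by (simp add: k_def)
    also have "norm \<dots> \<le> norm (g (P p) - g (P q), 0::real) + norm (0::real, h (P p) - h (P q))"
      by (rule norm_triangle_ineq)
    also have "\<dots> \<le> L * dist (P p) (P q) + L * dist (P p) (P q)"
      using lipschitz_onD[OF g P P, of p q] lipschitz_onD[OF h P P, of p q]
      by (intro add_mono) (auto simp: dist_norm)
    also have "\<dots> \<le> L * dist p q + L * dist p q" using P1[of p q] L by (intro add_mono mult_left_mono)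
    finally show "dist (k p) (k q) \<le> 2 * L * dist p q" by (simp add: dist_norm)
  qed (use L in simp)
  define M where "M = norm (k z0) + 2 * L * r"
  have kM: "norm (k p) \<le> M" for p
  proof -
    have "k p = k (P p)" using Pid[OF P[of p]] by (simp add: k_def)
    then have "norm (k p - k z0) \<le> 2 * L * dist (P p) z0"
      using lipschitz_onD[OF klip, of "P p" z0] by (simp add: dist_norm)
    also have "\<dots> \<le> 2 * L * r" using P[of p] L by (intro mult_left_mono) (auto simp: dist_commute)
    finally show ?thesis using norm_triangle_sub[of "k p" "k z0"] by (simp add: M_def)
  qed
  have M: "M \<ge> 0" using kM[of 0] norm_ge_zero order_trans by blast
  \<comment> \<open>The first bound gives the contraction condition, as \<open>k\<close> has
    Lipschitz constant \<open>2 * L\<close>; the second keeps a path of speed at most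
    \<open>2 * M\<close> within distance \<open>r\<close>. Adding \<open>1\<close> avoids zero
    denominators.\<close>
  define T where "T = min (1 / (8 * L + 1)) (r / (2 * M + 1))"
  have T: "T > 0" using L M r by (simp add: T_def)
  have "8 * L * T \<le> 8 * L * (1 / (8 * L + 1))" using L by (intro mult_left_mono) (auto simp: T_def)
  also have "\<dots> \<le> 1" using L by (simp add: field_simps)
  finally have LT: "4 * (2 * L) * T \<le> 1" by simp
  have "2 * M * T \<le> 2 * M * (r / (2 * M + 1))" using M by (intro mult_left_mono) (auto simp: T_def)
  also have "\<dots> \<le> r" using M r by (simp add: field_simps)
  finally have MT: "2 * M * T \<le> r" .
  obtain z where z: "z 0 = z0" "(2 * M)-lipschitz_on {0..T} z" "\<And>t. t \<in> {0..T} \<Longrightarrow> snd (z t) \<le> c"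
    "\<And>t. t \<in> {0..T} \<Longrightarrow> snd (z t) < c \<Longrightarrow> (z has_vector_derivative k (z t)) (at t within {0..T})"
    "AE t in lebesgue. t \<in> {0..T} \<longrightarrow> snd (z t) = c \<longrightarrow>
      snd (k (z t)) \<ge> 0 \<and> (z has_vector_derivative (fst (k (z t)), 0)) (at t within {0..T})"
    by (rule reflected_ode_solution[OF klip kM T LT z0]) (rule that)
  have zr: "z t \<in> cball z0 r" if t: "t \<in> {0..T}" for t
  proof -
    have "dist (z 0) (z t) \<le> 2 * M * dist 0 t" using lipschitz_onD[OF z(2), of 0 t] t T by auto
    also have "\<dots> \<le> 2 * M * T" using t M by (intro mult_left_mono) (auto simp: dist_real_def)
    finally show ?thesis using MT z(1) by simp
  qed
  have kz: "k (z t) = (g (z t), h (z t))" if "t \<in> {0..T}" for t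
    using Pid[OF zr[OF that]] by (simp add: k_def)
  show ?thesis
  proof (rule that[OF T z(1,2) zr z(3)])
    show "(z has_vector_derivative (g (z t), h (z t))) (at t within {0..T})" if "t \<in> {0..T}" "snd (z t) < c" for t
      using z(4)[OF that] kz[OF that(1)] by simp
    show "AE t in lebesgue. t \<in> {0..T} \<longrightarrow> snd (z t) = c \<longrightarrow>
      h (z t) \<ge> 0 \<and> (z has_vector_derivative (g (z t), 0)) (at t within {0..T})"
      using z(5) by eventually_elim (use kz in auto)
  qed
qed

section \<open>Existence\<close>

lemma filippov_map_mem_upper:
  assumes "C1_plane G" "C1_plane H" "snd z \<ge> 1"
  shows "(G z, - \<bar>H z\<bar>) \<in> filippov_map (field G H) z"
proof (rule filippov_map_limit)
  show "open (UNIV \<times> {1<..} :: (real \<times> real) set)" by (intro open_Times open_UNIV open_greaterThan)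
  show "z \<in> closure (UNIV \<times> {1<..})" using assms(3) by (cases z) (simp add: closure_Times)
  show "field G H p = (G p, - \<bar>H p\<bar>)" if "p \<in> UNIV \<times> {1<..}" for p
    using that by (cases p) (simp add: field_def)
  show "isCont (\<lambda>p. (G p, - \<bar>H p\<bar>)) z"
    by (intro isCont_Pair continuous_minus continuous_rabs C1_plane_isCont assms)
qed

lemma filippov_map_mem_strip:
  assumes "C1_plane G" "C1_plane H" "snd z \<in> {0..1}"
  shows "(G z, H z) \<in> filippov_map (field G H) z"
proof (rule filippov_map_limit)
  show "open (UNIV \<times> {0<..<1} :: (real \<times> real) set)" by (intro open_Times open_UNIV open_greaterThanLessThan)
  show "z \<in> closure (UNIV \<times> {0<..<1})" using assms(3) by (cases z) (simp add: closure_Times)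
  show "field G H p = (G p, H p)" if "p \<in> UNIV \<times> {0<..<1}" for p
    using that by (cases p) (simp add: field_def)
  show "isCont (\<lambda>p. (G p, H p)) z" by (intro isCont_Pair C1_plane_isCont assms)
qed

lemma filippov_map_mem_lower:
  assumes "C1_plane G" "C1_plane H" "snd z \<le> 0"
  shows "(G z, \<bar>H z\<bar>) \<in> filippov_map (field G H) z"
proof (rule filippov_map_limit)
  show "open (UNIV \<times> {..<0} :: (real \<times> real) set)" by (intro open_Times open_UNIV open_lessThan)
  show "z \<in> closure (UNIV \<times> {..<0})" using assms(3) by (cases z) (simp add: closure_Times)
  show "field G H p = (G p, \<bar>H p\<bar>)" if "p \<in> UNIV \<times> {..<0}" for p
    using that by (cases p) (simp add: field_def)
  show "isCont (\<lambda>p. (G p, \<bar>H p\<bar>)) z"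
    by (intro isCont_Pair continuous_rabs C1_plane_isCont assms)
qed

lemma filippov_map_midpoint_zero:
  assumes "(a, b) \<in> filippov_map F z" "(a, - b) \<in> filippov_map F z"
  shows "(a, 0) \<in> filippov_map F z"
proof -
  have "(1/2) *\<^sub>R (a, b) + (1/2) *\<^sub>R (a, - b) \<in> filippov_map F z"
    by (rule convexD[OF convex_filippov_map assms]) auto
  then show ?thesis by simp
qed

text \<open>The sign condition turns the outer branch, \<open>- abs (H z)\<close> above or
  \<open>abs (H z)\<close> below, into \<open>- H z\<close> in both cases, so its midpoint with the
  inner branch has no vertical component.\<close>

lemma filippov_map_mem_sliding:
  assumes GH: "C1_plane G" "C1_plane H" and z: "snd z = 1 \<and> H z \<ge> 0 \<or> snd z = 0 \<and> H z \<le> 0"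
  shows "(G z, 0) \<in> filippov_map (field G H) z"
proof (rule filippov_map_midpoint_zero)
  show "(G z, H z) \<in> filippov_map (field G H) z" by (rule filippov_map_mem_strip[OF GH]) (use z in auto)
  show "(G z, - H z) \<in> filippov_map (field G H) z"
    using z filippov_map_mem_upper[OF GH, of z] filippov_map_mem_lower[OF GH, of z] by auto
qed

section \<open>Local solutions from each initial position\<close>

lemma filippov_solution_Icc:
  assumes z: "C-lipschitz_on {0..T} z"
    and der: "AE t in lebesgue. t \<in> {0..T} \<longrightarrow>
      (\<exists>v. (z has_vector_derivative v) (at t within {0..T}) \<and> v \<in> filippov_map F (z t))"
  shows "filippov_solution F z {0..T}"
  unfolding filippov_solution_def loc_abs_cont_on_def
proof (intro conjI allI impI)
  show "abs_cont_on z a b" if "{a..b} \<subseteq> {0..T}" for a b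
    by (rule lipschitz_imp_abs_cont_on[OF lipschitz_on_subset[OF z that]])
qed (use der in \<open>simp_all add: is_interval_cc\<close>)

lemma lipschitz_on_abs:
  fixes h :: "'a::metric_space \<Rightarrow> real"
  assumes "L-lipschitz_on S h"
  shows "L-lipschitz_on S (\<lambda>p. \<bar>h p\<bar>)"
proof (rule lipschitz_onI)
  show "dist \<bar>h p\<bar> \<bar>h q\<bar> \<le> L * dist p q" if "p \<in> S" "q \<in> S" for p q
    using lipschitz_onD[OF assms that] abs_triangle_ineq3[of "h p" "h q"] by (simp add: dist_real_def)
qed (use assms in \<open>simp add: lipschitz_on_def\<close>)

lemma lipschitz_on_uminus:
  fixes h :: "'a::metric_space \<Rightarrow> real"
  assumes "L-lipschitz_on S h"
  shows "L-lipschitz_on S (\<lambda>p. - h p)"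
  using assms by (simp add: lipschitz_on_def dist_minus)

lemma snd_near_of_cball:
  fixes p z :: "real \<times> real"
  assumes "p \<in> cball z r"
  shows "\<bar>snd p - snd z\<bar> \<le> r"
  using order_trans[OF dist_snd_le[of z p]] assms by (simp add: dist_real_def abs_minus_commute)

lemma C1_plane_lipschitz_on_cball_at:
  assumes "C1_plane G" "C1_plane H"
  obtains L where "L-lipschitz_on (cball z r) G" "L-lipschitz_on (cball z r) H"
proof -
  obtain L where L: "L-lipschitz_on (cball 0 (norm z + r)) G" "L-lipschitz_on (cball 0 (norm z + r)) H"
    using C1_plane_common_lipschitz_on_cball[OF assms] by metis
  have "cball z r \<subseteq> cball 0 (norm z + r)"
  proof
    fix p assume "p \<in> cball z r"
    then have "norm (p - z) \<le> r" by (simp add: dist_norm norm_minus_commute)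
    then show "p \<in> cball 0 (norm z + r)" using norm_triangle_sub[of p z] by simp
  qed
  with L show ?thesis by (meson lipschitz_on_subset that)
qed

text \<open>
  The barrier height \<open>snd z0 + r + 1\<close> is never reached, so the reflected equation is the plain one.
\<close>

lemma filippov_solution_exists_off_switching:
  assumes GH: "C1_plane G" "C1_plane H"
    and h: "\<And>L. L-lipschitz_on (cball z0 r) H \<Longrightarrow> L-lipschitz_on (cball z0 r) h" and r: "r > 0"
    and mem: "\<And>p. p \<in> cball z0 r \<Longrightarrow> (G p, h p) \<in> filippov_map (field G H) p"
  shows "\<exists>T>0. \<exists>z. z 0 = z0 \<and> filippov_solution (field G H) z {0..T}"
proof -
  obtain L where L: "L-lipschitz_on (cball z0 r) G" "L-lipschitz_on (cball z0 r) H"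
    using C1_plane_lipschitz_on_cball_at[OF GH] by metis
  obtain T C z where z: "T > 0" "z 0 = z0" "C-lipschitz_on {0..T} z"
    "\<And>t. t \<in> {0..T} \<Longrightarrow> z t \<in> cball z0 r"
    "\<And>t. t \<in> {0..T} \<Longrightarrow> snd (z t) < snd z0 + r + 1 \<Longrightarrow> (z has_vector_derivative (G (z t), h (z t))) (at t within {0..T})"
    by (rule local_reflected_ode_solution[OF L(1) h[OF L(2)] r, of "snd z0 + r + 1"]) (use r in simp, rule that)
  have "filippov_solution (field G H) z {0..T}"
  proof (rule filippov_solution_Icc[OF z(3)], rule AE_I2, rule impI)
    fix t assume t: "t \<in> {0..T}"
    have "snd (z t) < snd z0 + r + 1" using snd_near_of_cball[OF z(4)[OF t]] by linarith
    then show "\<exists>v. (z has_vector_derivative v) (at t within {0..T}) \<and> v \<in> filippov_map (field G H) (z t)"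
      using z(5)[OF t] mem[OF z(4)[OF t]] by blast
  qed
  then show ?thesis using z(1,2) by blast
qed

lemma filippov_solution_exists_top:
  assumes GH: "C1_plane G" "C1_plane H" and z0: "snd z0 = 1"
  shows "\<exists>T>0. \<exists>z. z 0 = z0 \<and> filippov_solution (field G H) z {0..T}"
proof -
  \<comment> \<open>Radius \<open>1\<close> is the width of the strip: starting at height
    \<open>1\<close>, the solution does not get below \<open>0\<close>, so the strip branch remains
    admissible.\<close>
  obtain L where L: "L-lipschitz_on (cball z0 1) G" "L-lipschitz_on (cball z0 1) H"
    using C1_plane_lipschitz_on_cball_at[OF GH] by metis
  obtain T C z where z: "T > 0" "z 0 = z0" "C-lipschitz_on {0..T} z"
    "\<And>t. t \<in> {0..T} \<Longrightarrow> z t \<in> cball z0 1" "\<And>t. t \<in> {0..T} \<Longrightarrow> snd (z t) \<le> 1"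
    "\<And>t. t \<in> {0..T} \<Longrightarrow> snd (z t) < 1 \<Longrightarrow> (z has_vector_derivative (G (z t), H (z t))) (at t within {0..T})"
    "AE t in lebesgue. t \<in> {0..T} \<longrightarrow> snd (z t) = 1 \<longrightarrow>
      H (z t) \<ge> 0 \<and> (z has_vector_derivative (G (z t), 0)) (at t within {0..T})"
    by (rule local_reflected_ode_solution[OF L zero_less_one, of 1]) (use z0 in simp, rule that)
  have "filippov_solution (field G H) z {0..T}"
  proof (rule filippov_solution_Icc[OF z(3)])
    show "AE t in lebesgue. t \<in> {0..T} \<longrightarrow>
        (\<exists>v. (z has_vector_derivative v) (at t within {0..T}) \<and> v \<in> filippov_map (field G H) (z t))"
      using z(7)
    proof (eventually_elim, intro impI)
      fix t assume 1: "t \<in> {0..T} \<longrightarrow> snd (z t) = 1 \<longrightarrow>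
          H (z t) \<ge> 0 \<and> (z has_vector_derivative (G (z t), 0)) (at t within {0..T})" and t: "t \<in> {0..T}"
      show "\<exists>v. (z has_vector_derivative v) (at t within {0..T}) \<and> v \<in> filippov_map (field G H) (z t)"
      proof (cases "snd (z t) = 1")
        case True
        then show ?thesis using 1 t filippov_map_mem_sliding[OF GH, of "z t"] by blast
      next
        case False
        then have "snd (z t) < 1" using z(5)[OF t] by simp
        moreover have "snd (z t) \<in> {0..1}" using snd_near_of_cball[OF z(4)[OF t]] z(5)[OF t] z0 by auto
        ultimately show ?thesis using z(6)[OF t] filippov_map_mem_strip[OF GH] by blast
      qed
    qed
  qed
  then show ?thesis using z(1,2) by blast
qed

text \<open>The linear isometry \<open>\<sigma>\<close> fixes \<open>z0\<close> and turns the lower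
  barrier into an upper one at \<open>c = 0\<close>, the case already treated. It flips the sign of
  the second drift component, whence the drift \<open>- H (\<sigma> p)\<close>; outward drift of the
  mirror image means \<open>H \<le> 0\<close> for the solution itself.\<close>

lemma filippov_solution_exists_bottom:
  assumes GH: "C1_plane G" "C1_plane H" and z0: "snd z0 = 0"
  shows "\<exists>T>0. \<exists>z. z 0 = z0 \<and> filippov_solution (field G H) z {0..T}"
proof -
  define \<sigma> where "\<sigma> p = (fst p, - snd p)" for p :: "real \<times> real"
  have \<sigma>\<sigma>: "\<sigma> (\<sigma> p) = p" for p by (simp add: \<sigma>_def)
  have \<sigma>dist: "dist (\<sigma> p) (\<sigma> q) = dist p q" for p q
    by (simp add: \<sigma>_def dist_prod_def dist_minus)
  have \<sigma>0: "\<sigma> z0 = z0" using z0 by (simp add: \<sigma>_def prod_eq_iff)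
  have \<sigma>lin: "bounded_linear \<sigma>" unfolding \<sigma>_def
    by (intro bounded_linear_Pair bounded_linear_fst bounded_linear_minus bounded_linear_snd)
  obtain L where L: "L-lipschitz_on (cball z0 1) G" "L-lipschitz_on (cball z0 1) H"
    using C1_plane_lipschitz_on_cball_at[OF GH] by metis
  have \<sigma>cball: "\<sigma> p \<in> cball z0 1" if "p \<in> cball z0 1" for p
    using that \<sigma>dist[of z0 p] \<sigma>0 by simp
  have refl: "L-lipschitz_on (cball z0 1) (\<lambda>p. f (\<sigma> p))" if "L-lipschitz_on (cball z0 1) f" for f :: "real \<times> real \<Rightarrow> real"
    using that \<sigma>cball \<sigma>dist unfolding lipschitz_on_def by metis
  obtain T C y where y: "T > 0" "y 0 = z0" "C-lipschitz_on {0..T} y"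
    "\<And>t. t \<in> {0..T} \<Longrightarrow> y t \<in> cball z0 1" "\<And>t. t \<in> {0..T} \<Longrightarrow> snd (y t) \<le> 0"
    "\<And>t. t \<in> {0..T} \<Longrightarrow> snd (y t) < 0 \<Longrightarrow> (y has_vector_derivative (G (\<sigma> (y t)), - H (\<sigma> (y t)))) (at t within {0..T})"
    "AE t in lebesgue. t \<in> {0..T} \<longrightarrow> snd (y t) = 0 \<longrightarrow>
      - H (\<sigma> (y t)) \<ge> 0 \<and> (y has_vector_derivative (G (\<sigma> (y t)), 0)) (at t within {0..T})"
    by (rule local_reflected_ode_solution[OF refl[OF L(1)] lipschitz_on_uminus[OF refl[OF L(2)]] zero_less_one, of 0]) (use z0 in simp, rule that)
  define z where "z t = \<sigma> (y t)" for t
  have zder: "(z has_vector_derivative \<sigma> v) (at t within {0..T})"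
    if "(y has_vector_derivative v) (at t within {0..T})" for v t
    unfolding z_def by (rule bounded_linear.has_vector_derivative[OF \<sigma>lin that])
  have sndz: "snd (z t) = - snd (y t)" for t by (simp add: z_def \<sigma>_def)
  have "filippov_solution (field G H) z {0..T}"
  proof (rule filippov_solution_Icc)
    show "C-lipschitz_on {0..T} z" using y(3) by (simp add: lipschitz_on_def z_def \<sigma>dist)
    show "AE t in lebesgue. t \<in> {0..T} \<longrightarrow>
        (\<exists>v. (z has_vector_derivative v) (at t within {0..T}) \<and> v \<in> filippov_map (field G H) (z t))"
      using y(7)
    proof (eventually_elim, intro impI)
      fix t assume 1: "t \<in> {0..T} \<longrightarrow> snd (y t) = 0 \<longrightarrow>
          - H (\<sigma> (y t)) \<ge> 0 \<and> (y has_vector_derivative (G (\<sigma> (y t)), 0)) (at t within {0..T})" and t: "t \<in> {0..T}"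
      show "\<exists>v. (z has_vector_derivative v) (at t within {0..T}) \<and> v \<in> filippov_map (field G H) (z t)"
      proof (cases "snd (y t) = 0")
        case True
        then have "H (z t) \<le> 0" "(z has_vector_derivative (G (z t), 0)) (at t within {0..T})"
          using 1 t zder[of "(G (\<sigma> (y t)), 0)" t] by (auto simp: z_def \<sigma>_def)
        then show ?thesis using filippov_map_mem_sliding[OF GH, of "z t"] True sndz by auto
      next
        case False
        then have "snd (y t) < 0" using y(5)[OF t] by simp
        then have "(z has_vector_derivative (G (z t), H (z t))) (at t within {0..T})"
          using zder[OF y(6)[OF t]] by (simp add: z_def \<sigma>_def)
        moreover have "snd (z t) \<in> {0..1}"
          using snd_near_of_cball[OF y(4)[OF t]] y(5)[OF t] z0 sndz[of t] by auto
        ultimately show ?thesis using filippov_map_mem_strip[OF GH] by blast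
      qed
    qed
  qed
  moreover have "z 0 = z0" by (simp add: z_def y(2) \<sigma>0)
  ultimately show ?thesis using y(1) by blast
qed

lemma filippov_solution_exists:
  assumes GH: "C1_plane G" "C1_plane H"
  shows "\<exists>T>0. \<exists>z. z 0 = z0 \<and> filippov_solution (field G H) z {0..T}"
proof -
  consider "snd z0 > 1" | "snd z0 = 1" | "0 < snd z0" "snd z0 < 1" | "snd z0 = 0" | "snd z0 < 0" by linarith
  then show ?thesis
  proof cases
    case 1
    show ?thesis
    \<comment> \<open>Here and in the other two cases off the lines the radius is the distance to
      the nearest switching line. The closed ball may touch that line, which is harmless: the branch
      value is still a one-sided limit there.\<close>
    proof (rule filippov_solution_exists_off_switching[OF GH, of _ "snd z0 - 1"])
      show "L-lipschitz_on (cball z0 (snd z0 - 1)) (\<lambda>p. - \<bar>H p\<bar>)" if "L-lipschitz_on (cball z0 (snd z0 - 1)) H" for L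
        by (intro lipschitz_on_uminus lipschitz_on_abs that)
      show "(G p, - \<bar>H p\<bar>) \<in> filippov_map (field G H) p" if "p \<in> cball z0 (snd z0 - 1)" for p
        using snd_near_of_cball[OF that] by (intro filippov_map_mem_upper[OF GH]) linarith
    qed (use 1 in simp)
  next
    case 2
    then show ?thesis by (rule filippov_solution_exists_top[OF GH])
  next
    case 3
    show ?thesis
    proof (rule filippov_solution_exists_off_switching[OF GH, of _ "min (snd z0) (1 - snd z0)" H])
      show "(G p, H p) \<in> filippov_map (field G H) p" if "p \<in> cball z0 (min (snd z0) (1 - snd z0))" for p
        using snd_near_of_cball[OF that] by (intro filippov_map_mem_strip[OF GH]) (auto simp: abs_le_iff)
    qed (use 3 in auto)
  next
    case 4
    then show ?thesis by (rule filippov_solution_exists_bottom[OF GH])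
  next
    case 5
    show ?thesis
    proof (rule filippov_solution_exists_off_switching[OF GH, of _ "- snd z0"])
      show "L-lipschitz_on (cball z0 (- snd z0)) (\<lambda>p. \<bar>H p\<bar>)" if "L-lipschitz_on (cball z0 (- snd z0)) H" for L
        by (intro lipschitz_on_abs that)
      show "(G p, \<bar>H p\<bar>) \<in> filippov_map (field G H) p" if "p \<in> cball z0 (- snd z0)" for p
        using snd_near_of_cball[OF that] by (intro filippov_map_mem_lower[OF GH]) linarith
    qed (use 5 in simp)
  qed
qed

theorem theorem3p1:
  fixes G H :: "real \<times> real \<Rightarrow> real"
  assumes "C1_plane G" and "C1_plane H"
  shows "(\<forall>z0. \<exists>T>0. \<exists>z. z 0 = z0 \<and> filippov_solution (field G H) z {0..T})
       \<and> (\<forall>z1 z2 I1 I2. filippov_solution (field G H) z1 I1 \<and> filippov_solution (field G H) z2 I2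
            \<and> 0 \<in> I1 \<and> 0 \<in> I2 \<and> I1 \<subseteq> {0..} \<and> I2 \<subseteq> {0..} \<and> z1 0 = z2 0
            \<longrightarrow> (\<forall>t\<in>I1 \<inter> I2. z1 t = z2 t))
       \<and> (\<forall>z I. filippov_solution (field G H) z I \<and> 0 \<in> I \<and> I \<subseteq> {0..}
            \<and> snd (z 0) \<in> {0..1} \<longrightarrow> (\<forall>t\<in>I. snd (z t) \<in> {0..1}))"
proof (intro conjI allI impI ballI)
  show "\<exists>T>0. \<exists>z. z 0 = z0 \<and> filippov_solution (field G H) z {0..T}" for z0
    by (rule filippov_solution_exists[OF assms])
next
  fix z1 z2 I1 I2 t
  assume H: "filippov_solution (field G H) z1 I1 \<and> filippov_solution (field G H) z2 I2
      \<and> 0 \<in> I1 \<and> 0 \<in> I2 \<and> I1 \<subseteq> {0..} \<and> I2 \<subseteq> {0..} \<and> z1 0 = z2 0" and t: "t \<in> I1 \<inter> I2"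
  then have "0 \<le> t" by (meson IntD1 atLeast_iff subsetD)
  with H t show "z1 t = z2 t" by (blast intro: filippov_solution_unique[OF assms])
next
  fix z I t
  assume H: "filippov_solution (field G H) z I \<and> 0 \<in> I \<and> I \<subseteq> {0..} \<and> snd (z 0) \<in> {0..1}" and t: "t \<in> I"
  then have "0 \<le> t" by (meson atLeast_iff subsetD)
  with H t show "snd (z t) \<in> {0..1}" by (blast intro: filippov_solution_strip_invariant)
qed

end
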